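(* For any countable family of parallel lines $\{L_j\colon j=1,2,\dots\}$ in $\mathbb{C}$ there exists a quasiconformal mapping $f\colon\mathbb{C}\to\mathbb{C}$ such that, for every $j$, every nontrivial subarc of $f(L_j)$ is unrectifiable.
   Context: A homeomorphism $f\colon\mathbb{C}\to\mathbb{C}$ in $W^{1,2}_{\mathrm{loc}}(\mathbb{C};\mathbb{C})$ is quasiconformal if there is $K$ with $1\le K<\infty$ such that $\|Df(x)\|^2\le K\,J(x,f)$ for a.e. $x$, where $\|Df(x)\|$ is the operator norm of the differential matrix and $J(x,f)$ its determinant. An arc is unrectifiable if it has infinite length; a subarc is nontrivial if it is not a single point. *)

theory Defs
  imports "HOL-Analysis.Analysis"
begin

primrec C_k :: "nat \<Rightarrow> (complex \<Rightarrow> real) \<Rightarrow> bool" where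
  "C_k 0 \<phi> \<longleftrightarrow> continuous_on UNIV \<phi>"
| "C_k (Suc k) \<phi> \<longleftrightarrow> \<phi> differentiable_on UNIV \<and>
     (\<forall>v. C_k k (\<lambda>z. frechet_derivative \<phi> (at z) v))"

definition test_function :: "(complex \<Rightarrow> real) \<Rightarrow> bool" where
  "test_function \<phi> \<longleftrightarrow> (\<forall>k. C_k k \<phi>) \<and> compact (closure {z. \<phi> z \<noteq> 0})"

definition L2_loc :: "(complex \<Rightarrow> complex) \<Rightarrow> bool" where
  "L2_loc f \<longleftrightarrow> f \<in> borel_measurable lebesgue \<and>
     (\<forall>K. compact K \<longrightarrow> set_integrable lebesgue K (\<lambda>z. (norm (f z))\<^sup>2))"

text \<open>Only meaningful for locally integrable \<open>f\<close> and \<open>g\<close>, where both integrands are integrable.\<close>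

definition weak_derivative :: "complex \<Rightarrow> (complex \<Rightarrow> complex) \<Rightarrow> (complex \<Rightarrow> complex) \<Rightarrow> bool" where
  "weak_derivative v f g \<longleftrightarrow>
     (\<forall>\<phi>. test_function \<phi> \<longrightarrow>
        (LINT z|lebesgue. frechet_derivative \<phi> (at z) v *\<^sub>R f z) = - (LINT z|lebesgue. \<phi> z *\<^sub>R g z))"

text \<open>\<open>f\<close> belongs to the local Sobolev space \<open>W\<^sup>1\<^sup>,\<^sup>2\<close>, with weak partial derivatives
  \<open>fx\<close> and \<open>fy\<close>, which are unique up to a null set.\<close>

definition W12_loc :: "(complex \<Rightarrow> complex) \<Rightarrow> (complex \<Rightarrow> complex) \<Rightarrow> (complex \<Rightarrow> complex) \<Rightarrow> bool" where
  "W12_loc f fx fy \<longleftrightarrow> L2_loc f \<and> L2_loc fx \<and> L2_loc fy \<and>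
     weak_derivative 1 f fx \<and> weak_derivative \<i> f fy"

definition differential_matrix :: "complex \<Rightarrow> complex \<Rightarrow> real^2^2" where
  "differential_matrix a b = vector [vector [Re a, Re b], vector [Im a, Im b]]"

definition quasiconformal :: "(complex \<Rightarrow> complex) \<Rightarrow> bool" where
  "quasiconformal f \<longleftrightarrow>
     (\<exists>g. homeomorphism UNIV UNIV f g) \<and>
     (\<exists>fx fy. W12_loc f fx fy \<and>
        (\<exists>K::real. 1 \<le> K \<and>
           (AE z in lebesgue.
              (onorm ((*v) (differential_matrix (fx z) (fy z))))\<^sup>2
                \<le> K * det (differential_matrix (fx z) (fy z)))))"

text \<open>The length of a path is the supremum of the lengths of its inscribed polygonal lines.\<close>

definition curve_length :: "(real \<Rightarrow> complex) \<Rightarrow> ennreal" where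
  "curve_length \<gamma> = (SUP ts \<in> {ts. sorted ts \<and> set ts \<subseteq> {0..1}}.
     \<Sum>i<length ts - 1. ennreal (dist (\<gamma> (ts ! i)) (\<gamma> (ts ! Suc i))))"

definition line :: "complex set \<Rightarrow> bool" where
  "line L \<longleftrightarrow> affine L \<and> aff_dim L = 1"

text \<open>An \<^const>\<open>arc\<close> is injective on \<open>{0..1}\<close>, so its image is never a single point.
  The length of an arc as a point set does not depend on the parametrization \<open>\<gamma>\<close>.\<close>

definition nontrivial_subarc :: "(real \<Rightarrow> complex) \<Rightarrow> complex set \<Rightarrow> bool" where
  "nontrivial_subarc \<gamma> S \<longleftrightarrow> arc \<gamma> \<and> path_image \<gamma> \<subseteq> S"

definition unrectifiable :: "(real \<Rightarrow> complex) \<Rightarrow> bool" where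
  "unrectifiable \<gamma> \<longleftrightarrow> curve_length \<gamma> = \<infinity>"

end

theory Submission
  imports Defs
begin

text \<open>
  After a rotation the lines are \<open>Im z = y j\<close>, so only \<open>f(x + i * y j)\<close> has to be made wild. The map is
  \<open>f(z) = z + i * grad \<Phi>(z)\<close> with a real potential \<open>\<Phi>\<close>. In Wirtinger derivatives, \<open>f\<^sub>z\<close> is \<open>1\<close> plus \<open>i\<close> times
  half the Laplacian of \<open>\<Phi>\<close>, hence has real part one, however large the Laplacian is. If the conjugate
  derivative \<open>f\<^sub>w\<close> (with \<open>w = cnj z\<close>), which involves only \<open>\<Phi>\<^sub>x\<^sub>x - \<Phi>\<^sub>y\<^sub>y\<close> and \<open>\<Phi>\<^sub>x\<^sub>y\<close>, stays below \<open>1/3\<close> in modulus,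
  then the distortion is bounded by \<open>2\<close>, and the imaginary part of \<open>f\<^sub>z\<close> drops out of
  \<open>Re ((f a - f b) * cnj (a - b)) \<ge> 2/3 * |a - b|\<^sup>2\<close>. This inequality survives uniform limits and makes \<open>f\<close>
  injective with closed range; the range is open by invariance of domain, so \<open>f\<close> is a homeomorphism.
  The admissible potentials form a convex set, which allows all lines to be treated at once.

  The potential is a sum of terms \<open>a * r\<^sup>2 * sin (x / r) * bump ((y - h) / r)\<close>, where \<open>h\<close> is the height of one
  of the lines and \<open>bump\<close> is compactly supported with \<open>bump'' 0 = - bump 0\<close> and \<open>bump' 0 = 0\<close>. Therefore the
  contribution of a term to \<open>f\<^sub>w\<close> is at most \<open>2 * a * |y - h| / r\<close> near the line and zero away from it, and for
  each line the contributions of rapidly decreasing \<open>r\<close> form a geometric series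
  (\<open>sum_truncated_ratio_le\<close>). Every line occurs infinitely often, with amplitudes \<open>a\<close> that depend on the line
  only and are summable over the lines. The derivative \<open>f\<^sub>z\<close> is unbounded, but it is a sum of functions
  supported in strips of width comparable to \<open>r\<close>, hence locally square integrable; the partial sums are
  continuously differentiable, and dominated convergence yields the weak derivatives
  (\<open>quasiconformal_limit\<close>).

  On each of the lines, the imaginary part of \<open>f\<close> is a constant plus a lacunary series
  \<open>W(x) = \<Sum>k. b k * r k * cos (x / r k)\<close> with \<open>b k\<close> in \<open>[0, 1]\<close> and infinitely many \<open>b k\<close> equal to the same
  positive number. Such a series has unbounded variation on every interval. Let \<open>S\<close> be a
  partial sum of \<open>\<Sum>k. b k * sin (x / r k)\<close>, which up to sign is the derivative of \<open>W\<close>. Since each new summand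
  oscillates much faster than the previous ones vary, it acts like an independent random variable: the
  integral of \<open>cis (\<tau> * S)\<close> gets multiplied, up to a summable error, by the mean of
  \<open>cis (\<tau> * b * sin \<theta>)\<close> and thus tends to \<open>0\<close>. If \<open>W\<close> had bounded variation, the integrals of \<open>|S|\<close> would stay
  bounded, and for small \<open>\<tau>\<close> the integral of \<open>cis (\<tau> * S)\<close> would stay close to the length of the interval,
  a contradiction. A subarc of the image of a line runs through the values of \<open>f\<close> on a nondegenerate
  interval, so it is at least as long as the variation of \<open>W\<close> there.
\<close>

section \<open>Oscillatory integrals\<close>

lemma has_vector_derivative_compose_affine:
  assumes "(H has_vector_derivative d) (at (c * x + e :: real))"
  shows "((\<lambda>x. H (c * x + e)) has_vector_derivative c *\<^sub>R d) (at x)"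
proof -
  have "((\<lambda>x. c * x + e) has_vector_derivative c) (at x)"
    unfolding has_real_derivative_iff_has_vector_derivative[symmetric]
    by (auto intro!: derivative_eq_intros)
  from vector_diff_chain_at[OF this assms] show ?thesis by (simp add: o_def)
qed

text \<open>Vanishing mean makes the primitive periodic, so its bound over one period is a global bound.\<close>

lemma bounded_periodic_antiderivative:
  fixes g :: "real \<Rightarrow> complex"
  assumes cont: "continuous_on UNIV g"
    and period: "\<And>x. g (x + p) = g x" and "p > 0"
    and mean: "integral {0..p} g = 0" and bound: "\<And>x. norm (g x) \<le> B"
  shows "\<exists>H. \<forall>x>A. (H has_vector_derivative g x) (at x) \<and> norm (H x) \<le> B * p"
proof -
  \<comment> \<open>this primitive is only meaningful for \<open>y \<ge> 0\<close>;
    it is shifted by a multiple of the period at the end to reach all \<open>x > A\<close>\<close>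
  define H where "H y = integral {0..y} g" for y
  have deriv: "(H has_vector_derivative g x) (at x)" if "x > 0" for x
  proof -
    have "(H has_vector_derivative g x) (at x within {0..x+1})"
      unfolding H_def using that
      by (intro integral_has_vector_derivative continuous_on_subset[OF cont]) auto
    then show ?thesis
      using that at_within_interior[of x "{0..x+1}"] by simp
  qed
  have int: "g integrable_on {a..b}" for a b
    by (intro integrable_continuous_real continuous_on_subset[OF cont]) auto
  have Hcont: "continuous_on {0..} H"
  proof (rule continuous_on_subset)
    have "continuous_on {0..b} H" for b
      unfolding H_def by (rule indefinite_integral_continuous_1[OF int])
    have "continuous (at x within {0..}) H" if "x \<ge> 0" for x
    proof -
      have "continuous (at x within {0..x+1}) H"
        using \<open>\<And>b. continuous_on {0..b} H\<close> that by (auto simp: continuous_on_eq_continuous_within)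
      moreover have "at x within {0..} = at x within {0..x+1}"
        by (rule at_within_nhd[of _ "{..<x+1}"]) auto
      ultimately show ?thesis by simp
    qed
    then show "continuous_on {0..} H"
      by (auto simp: continuous_on_eq_continuous_within)
  qed auto
  have Hper: "H (y + p) = H y" if "y \<ge> 0" for y
  proof -
    have "(\<lambda>y. H (y + p) - H y) y = (\<lambda>y. H (y + p) - H y) 0"
    proof (rule has_derivative_zero_unique_strong_interval[of "{0}" 0 y])
      show "continuous_on {0..y} (\<lambda>y. H (y + p) - H y)"
        using \<open>p > 0\<close>
        by (intro continuous_intros continuous_on_compose2[OF Hcont]
              continuous_on_subset[OF Hcont]) auto
      show "((\<lambda>y. H (y + p) - H y) has_derivative (\<lambda>h. 0)) (at x within {0..y})"
        if "x \<in> {0..y} - {0}" for x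
      proof -
        have "x > 0" using that by auto
        have "((\<lambda>y. H (y + p)) has_vector_derivative (1 *\<^sub>R g (x + p))) (at x)"
          using has_vector_derivative_compose_affine[of H "g (x + p)" 1 x p] deriv[of "x+p"]
            \<open>x > 0\<close> \<open>p > 0\<close> by simp
        from has_vector_derivative_diff[OF this deriv[OF \<open>x > 0\<close>]]
        have "((\<lambda>y. H (y + p) - H y) has_vector_derivative 0) (at x)"
          by (simp add: period)
        then show ?thesis
          unfolding has_vector_derivative_def by (auto intro: has_derivative_at_withinI)
      qed
      show "(\<lambda>y. H (y + p) - H y) 0 = (\<lambda>y. H (y + p) - H y) 0" ..
    qed (use that in auto)
    then show ?thesis by (simp add: H_def mean)
  qed
  have Hper_nat: "H (y + real n * p) = H y" if "y \<ge> 0" for y n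
  proof (induction n)
    case (Suc n)
    have "H ((y + real n * p) + p) = H (y + real n * p)"
      using that \<open>p > 0\<close> by (intro Hper) auto
    with Suc show ?case by (simp add: algebra_simps)
  qed auto
  have "B \<ge> 0" using bound[of 0] norm_ge_zero order_trans by blast
  have Hbound: "norm (H y) \<le> B * p" if "y \<ge> 0" for y
  proof -
    define n where "n = nat \<lfloor>y / p\<rfloor>"
    define z where "z = y - real n * p"
    have "real n \<le> y / p" "y / p < real n + 1"
      using that \<open>p > 0\<close> unfolding n_def by (auto simp: of_nat_nat)
    then have z: "0 \<le> z" "z \<le> p"
      using \<open>p > 0\<close> unfolding z_def by (auto simp: field_simps)
    have "H y = H z" using Hper_nat[of z n] z by (simp add: z_def)
    moreover have "norm (H z) \<le> B * (z - 0)"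
      unfolding H_def using z
      by (intro integral_bound continuous_on_subset[OF cont] bound) auto
    moreover have "B * (z - 0) \<le> B * p" using z \<open>B \<ge> 0\<close> by (simp add: mult_left_mono)
    ultimately show ?thesis by simp
  qed
  obtain n :: nat where n: "- A / p < real n"
    using reals_Archimedean2 by blast
  have pos: "x + real n * p > 0" if "x > A" for x
    using n that \<open>p > 0\<close> by (simp add: field_simps)
  have gper_nat: "g (x + real n * p) = g x" for x n
  proof (induction n)
    case (Suc n)
    then show ?case using period[of "x + real n * p"] by (simp add: algebra_simps)
  qed auto
  show ?thesis
  proof (intro exI[of _ "\<lambda>x. H (x + real n * p)"] allI impI conjI)
    fix x assume "x > A"
    show "((\<lambda>x. H (x + real n * p)) has_vector_derivative g x) (at x)"
      using has_vector_derivative_compose_affine[of H "g (x + real n * p)" 1 x "real n * p"]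
        deriv[OF pos[OF \<open>x > A\<close>]] by (simp add: gper_nat)
    show "norm (H (x + real n * p)) \<le> B * p"
      using pos[OF \<open>x > A\<close>] by (intro Hbound) auto
  qed
qed

text \<open>A quantitative Riemann--Lebesgue lemma: the fast factor \<open>G (x / r)\<close> may be replaced by its mean \<open>q\<close>.
  The function \<open>G (x / r) - q\<close> has a primitive of size \<open>r\<close>, and integration by parts moves the derivative to the
  slowly varying factor \<open>F\<close>.\<close>

lemma integral_mult_oscillation:
  fixes F F' G :: "real \<Rightarrow> complex"
  assumes "a \<le> b" "r > 0"
    and F: "\<And>x. (F has_vector_derivative F' x) (at x)" and F'cont: "continuous_on UNIV F'"
    and F1: "\<And>x. norm (F x) \<le> 1" and F'b: "\<And>x. norm (F' x) \<le> \<Lambda>"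
    and G: "continuous_on UNIV G" "\<And>x. G (x + 2 * pi) = G x" "\<And>x. norm (G x) \<le> 1"
    and q: "q = integral {0..2*pi} G / (2*pi)"
  shows "norm (integral {a..b} (\<lambda>x. F x * G (x / r)) - q * integral {a..b} F)
     \<le> 4 * pi * r * (2 + \<Lambda> * (b - a))"
proof -
  have "norm (integral {0..2*pi} G) \<le> 1 * (2*pi - 0)"
    by (intro integral_bound continuous_on_subset[OF G(1)] G(3)) auto
  then have q1: "norm q \<le> 1"
    unfolding q by (simp add: norm_divide field_simps)
  have contG: "continuous_on {s..t} G" for s t
    using G(1) by (rule continuous_on_subset) auto
  have "integral {0..2*pi} (\<lambda>x. G x - q) = integral {0..2*pi} G - (2*pi) *\<^sub>R q"
    by (subst integral_diff) (auto intro: integrable_continuous_real contG)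
  also have "\<dots> = 0" by (simp add: q scaleR_conv_of_real)
  finally have mean: "integral {0..2*pi} (\<lambda>x. G x - q) = 0" .
  have "norm (G x - q) \<le> 2" for x
    using norm_triangle_ineq4[of "G x" q] G(3)[of x] q1 by linarith
  then obtain H where H: "\<And>x. x > a / r - 1 \<Longrightarrow> (H has_vector_derivative G x - q) (at x)"
     "\<And>x. x > a / r - 1 \<Longrightarrow> norm (H x) \<le> 2 * (2 * pi)"
    using bounded_periodic_antiderivative[of "\<lambda>x. G x - q" "2 * pi" 2 "a / r - 1",
        OF continuous_on_diff[OF G(1) continuous_on_const]] G(2) mean pi_gt_zero
    by fastforce
  define K where "K x = r *\<^sub>R H (x / r)" for x
  have gt: "x / r > a / r - 1" if "x \<ge> a" for x
    using divide_right_mono[OF that, of r] \<open>r > 0\<close> by linarith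
  have K: "(K has_vector_derivative G (x / r) - q) (at x)" if "x \<ge> a" for x
  proof -
    have "((\<lambda>x. H (x / r)) has_vector_derivative (1 / r) *\<^sub>R (G (x / r) - q)) (at x)"
      using has_vector_derivative_compose_affine[of H "G (x / r) - q" "1 / r" x 0]
        H(1)[OF gt[OF that]] by simp
    from bounded_linear.has_vector_derivative[OF bounded_linear_scaleR_right this, of r]
    show ?thesis using \<open>r > 0\<close> unfolding K_def by simp
  qed
  have Kb: "norm (K x) \<le> 4 * pi * r" if "x \<ge> a" for x
    using H(2)[OF gt[OF that]] \<open>r > 0\<close> unfolding K_def by simp
  have Kcont: "continuous_on {a..b} K"
    by (rule continuous_on_vector_derivative[where f' = "\<lambda>x. G (x / r) - q"])
       (use K in \<open>auto intro: has_vector_derivative_at_within\<close>)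
  have Fcont: "continuous_on {a..b} F"
    by (rule continuous_on_vector_derivative[where f' = F'])
       (use F in \<open>auto intro: has_vector_derivative_at_within\<close>)
  have F'cont': "continuous_on {a..b} F'"
    using F'cont by (rule continuous_on_subset) auto
  define y where "y = F b * K b - F a * K a - integral {a..b} (\<lambda>x. F' x * K x)"
  have int': "((\<lambda>x. F' x * K x) has_integral integral {a..b} (\<lambda>x. F' x * K x)) {a..b}"
    by (intro integrable_integral integrable_continuous_real continuous_intros F'cont' Kcont)
  have "((\<lambda>x. (G (x / r) - q) * F x) has_integral y) {a..b}"
  proof (rule integration_by_parts[where prod = "(*)" and f = K and g = F and g' = F'])
    have "K b * F b - K a * F a - y = integral {a..b} (\<lambda>x. F' x * K x)"
      by (simp add: y_def)
    then show "((\<lambda>x. K x * F' x) has_integral K b * F b - K a * F a - y) {a..b}"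
      using int' by (simp add: mult.commute)
  qed (use assms K Kcont Fcont in \<open>auto intro: bounded_bilinear_mult\<close>)
  then have "integral {a..b} (\<lambda>x. (G (x / r) - q) * F x) = y" by (rule integral_unique)
  moreover have "integral {a..b} (\<lambda>x. (G (x / r) - q) * F x)
      = integral {a..b} (\<lambda>x. F x * G (x / r)) - q * integral {a..b} F"
  proof -
    have "integral {a..b} (\<lambda>x. (G (x / r) - q) * F x)
        = integral {a..b} (\<lambda>x. F x * G (x / r) - q * F x)"
      by (simp add: algebra_simps)
    also have "\<dots> = integral {a..b} (\<lambda>x. F x * G (x / r)) - integral {a..b} (\<lambda>x. q * F x)"
      using \<open>r > 0\<close> by (intro integral_diff integrable_continuous_real continuous_intros Fcont
         continuous_on_compose2[OF G(1)]) auto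
    finally show ?thesis by simp
  qed
  moreover have "norm y \<le> 4 * pi * r * (2 + \<Lambda> * (b - a))"
  proof -
    have e: "norm (F x * K x) \<le> 4 * pi * r" if "x \<ge> a" for x
      using mult_mono[OF F1[of x] Kb[OF that]] by (simp add: norm_mult)
    have "norm (integral {a..b} (\<lambda>x. F' x * K x)) \<le> (\<Lambda> * (4 * pi * r)) * (b - a)"
    proof (intro integral_bound continuous_intros F'cont' Kcont \<open>a \<le> b\<close>)
      fix x assume "x \<in> {a..b}"
      then show "norm (F' x * K x) \<le> \<Lambda> * (4 * pi * r)"
        unfolding norm_mult using F'b[of x] norm_ge_zero[of "F' x"]
        by (intro mult_mono F'b Kb) (auto intro: order_trans[OF norm_ge_zero F'b[of x]])
    qed
    moreover have "norm y \<le> norm (F b * K b) + norm (F a * K a)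
        + norm (integral {a..b} (\<lambda>x. F' x * K x))"
      unfolding y_def using norm_triangle_ineq4 by (smt (verit))
    ultimately show ?thesis
      using e[of a] e[of b] \<open>a \<le> b\<close> by (simp add: algebra_simps)
  qed
  ultimately show ?thesis by simp
qed

lemma cnj_sgn_mult_self: "cnj (sgn z) * z = of_real (norm z)"
proof (cases "z = 0")
  case False
  have "cnj (sgn z) * z = (z * cnj z) / of_real (norm z)"
    by (simp add: sgn_eq)
  also have "\<dots> = of_real (norm z)"
    using False by (simp add: complex_norm_square[symmetric] power2_eq_square)
  finally show ?thesis .
qed simp

text \<open>Equality would force the unimodular integrand to be constant, but it takes the values \<open>1\<close> at \<open>\<theta> = 0\<close>
  and \<open>cis t \<noteq> 1\<close> at \<open>\<theta> = pi / 2\<close>.\<close>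

lemma norm_mean_cis_sin_less_1:
  assumes "0 < t" "t < pi"
  shows "norm (integral {0..2*pi} (\<lambda>\<theta>. cis (t * sin \<theta>)) / (2*pi)) < 1"
proof (rule ccontr)
  let ?I = "integral {0..2*pi} (\<lambda>\<theta>. cis (t * sin \<theta>))"
  have cont: "continuous_on S (\<lambda>\<theta>. cis (t * sin \<theta>))" for S
    by (intro continuous_intros)
  assume "\<not> norm (?I / (2*pi)) < 1"
  then have ge: "norm ?I \<ge> 2 * pi" by (simp add: norm_divide field_simps)
  define w where "w = cnj (sgn ?I)"
  have "?I \<noteq> 0" using ge pi_gt_zero by (metis norm_zero not_less mult_pos_pos zero_less_numeral)
  then have w1: "norm w = 1" by (simp add: w_def norm_sgn)
  have wI: "w * ?I = norm ?I"
    unfolding w_def by (rule cnj_sgn_mult_self)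
  have "integral {0..2*pi} (\<lambda>\<theta>. 1 - Re (w * cis (t * sin \<theta>)))
      = 2 * pi - Re (integral {0..2*pi} (\<lambda>\<theta>. w * cis (t * sin \<theta>)))"
  proof -
    have i: "(\<lambda>\<theta>. w * cis (t * sin \<theta>)) integrable_on {0..2*pi}"
      by (intro integrable_continuous_real continuous_intros)
    have "((\<lambda>\<theta>. 1 - Re (w * cis (t * sin \<theta>))) has_integral
       (2 * pi - Re (integral {0..2*pi} (\<lambda>\<theta>. w * cis (t * sin \<theta>))))) {0..2*pi}"
      using has_integral_diff[OF has_integral_const_real[of "1::real" 0 "2*pi"]
          has_integral_linear[OF integrable_integral[OF i] bounded_linear_Re]]
      by (simp add: o_def)
    then show ?thesis by (rule integral_unique)
  qed
  also have "\<dots> = 2 * pi - norm ?I" using wI by simp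
  also have "\<dots> \<le> 0" using ge by simp
  finally have le0: "integral {0..2*pi} (\<lambda>\<theta>. 1 - Re (w * cis (t * sin \<theta>))) \<le> 0" .
  have nn: "1 - Re (w * cis (t * sin \<theta>)) \<ge> 0" for \<theta>
    using complex_Re_le_cmod[of "w * cis (t * sin \<theta>)"] w1 by (simp add: norm_mult)
  have "integral {0..2*pi} (\<lambda>\<theta>. 1 - Re (w * cis (t * sin \<theta>))) \<ge> 0"
    using nn by (intro integral_nonneg integrable_continuous_real continuous_intros) auto
  with le0 have "integral {0..2*pi} (\<lambda>\<theta>. 1 - Re (w * cis (t * sin \<theta>))) = 0" by simp
  then have *: "\<forall>\<theta>\<in>{0..2*pi}. 1 - Re (w * cis (t * sin \<theta>)) = 0"
    by (subst (asm) integral_eq_0_iff) (use nn in \<open>auto intro!: continuous_intros\<close>)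
  \<comment> \<open>a number of modulus one with real part one equals one\<close>
  have one: "w * cis (t * sin \<theta>) = 1" if "\<theta> \<in> {0..2*pi}" for \<theta>
  proof -
    have "Re (w * cis (t * sin \<theta>)) = 1" using * that by force
    moreover have "norm (w * cis (t * sin \<theta>)) = 1" by (simp add: norm_mult w1)
    ultimately show ?thesis
      using Im_eq_0[of "w * cis (t * sin \<theta>)"] by (intro complex_eqI) (simp_all del: times_complex.simps)
  qed
  have "w = 1" using one[of 0] by simp
  then have "cis t = 1" using one[of "pi/2"] by simp
  then have "sin t = 0" by (metis cis.simps(2) one_complex.simps(2))
  then show False using sin_gt_zero assms by fastforce
qed

section \<open>Unbounded variation of lacunary cosine series\<close>

lemma norm_cis_diff_1_le: "norm (cis y - 1) \<le> \<bar>y\<bar>"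
proof -
  have "(norm (cis y - 1))\<^sup>2 = (cos y - 1)\<^sup>2 + (sin y)\<^sup>2"
    by (simp add: cmod_power2)
  also have "\<dots> = 2 - 2 * cos y"
    using sin_cos_squared_add[of y] by (simp add: power2_eq_square algebra_simps)
  also have "\<dots> = (2 * sin (y/2))\<^sup>2"
    using cos_double_sin[of "y/2"] by (simp add: power2_eq_square)
  finally have "norm (cis y - 1) = \<bar>2 * sin (y/2)\<bar>"
    by (metis norm_ge_zero power2_eq_iff_nonneg abs_ge_zero power2_abs)
  then show ?thesis using abs_sin_x_le_abs_x[of "y/2"] by simp
qed

text \<open>Adding the tail \<open>2 * C * (1/2) ^ m\<close> of the errors makes the sequence decreasing, so \<open>x\<close> converges. Its limit
  \<open>l\<close> satisfies \<open>l \<le> t * l\<close> because the factor \<open>t\<close> occurs infinitely often.\<close>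

lemma contraction_infinitely_often_tendsto_0:
  fixes x \<theta> :: "nat \<Rightarrow> real"
  assumes nonneg: "\<And>m. 0 \<le> x m"
    and step: "\<And>m. x (Suc m) \<le> \<theta> m * x m + C * (1/2) ^ m"
    and \<theta>: "\<And>m. \<theta> m \<le> 1" and inf: "\<exists>\<^sub>\<infinity>m. \<theta> m = t" and "t < 1"
  shows "x \<longlonglongrightarrow> 0"
proof -
  define y where "y m = x m + 2 * C * (1/2) ^ m" for m
  have half: "(\<lambda>m. d * (1/2) ^ m) \<longlonglongrightarrow> (0::real)" for d
    using tendsto_mult_right_zero[OF LIMSEQ_realpow_zero[of "1/2"]] by simp
  have dec: "y (Suc m) \<le> y m" for m
    using step[of m] mult_right_mono[OF \<theta>[of m] nonneg[of m]] by (simp add: y_def)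
  have "bdd_below (range y)"
  proof (rule bdd_belowI2)
    show "- (2 * \<bar>C\<bar>) \<le> y m" for m
    proof -
      have "\<bar>2 * C * (1/2) ^ m\<bar> \<le> 2 * \<bar>C\<bar> * 1"
        unfolding abs_mult by (intro mult_mono) (auto simp: power_le_one)
      then show ?thesis using nonneg[of m] by (simp add: y_def)
    qed
  qed
  then obtain l where "y \<longlonglongrightarrow> l"
    using LIMSEQ_decseq_INF[of y] decseq_SucI[of y] dec by blast
  from tendsto_diff[OF this half[of "2 * C"]] have x: "x \<longlonglongrightarrow> l"
    by (simp add: y_def)
  have "l \<ge> 0" using LIMSEQ_le_const[OF x, of 0] nonneg by auto
  moreover have False if "l > 0"
  proof -
    have "t * l < l" using that \<open>t < 1\<close> by simp
    then obtain u where u: "t * l < u" "u < l" by (rule dense[THEN exE]) blast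
    have "(\<lambda>m. t * x m + C * (1/2) ^ m) \<longlonglongrightarrow> t * l + 0"
      by (intro tendsto_intros x half)
    then have "\<forall>\<^sub>F m in sequentially. t * x m + C * (1/2) ^ m < u"
      by (rule order_tendstoD(2)) (use u in simp)
    moreover have "\<forall>\<^sub>F m in sequentially. x (Suc m) > u"
      using LIMSEQ_Suc[OF x] by (rule order_tendstoD(1)) (use u in simp)
    ultimately have "\<forall>\<^sub>F m in sequentially. t * x m + C * (1/2) ^ m < x (Suc m)"
      by eventually_elim auto
    then have "\<forall>\<^sub>F m in sequentially. \<theta> m \<noteq> t"
      by (rule eventually_mono) (use step not_less in blast)
    then show False using inf by (simp add: cofinite_eq_sequentially[symmetric] frequently_def)
  qed
  ultimately show ?thesis using x by force
qed

text \<open>The ratios of consecutive scales have to be summable, because they measure how far consecutive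
  oscillations are from being independent. Infinitely many coefficients equal \<open>c\<close>; the others, in the
  application the traces of the terms attached to other lines, are only known to lie in \<open>[0, 1]\<close>.\<close>

locale lacunary_cosine_series =
  fixes b r :: "nat \<Rightarrow> real" and c :: real
  assumes r_pos: "r k > 0"
    and ratio: "r (Suc k) \<le> r k * (1/2) ^ Suc k"
    and b01: "0 \<le> b k" "b k \<le> 1"
    and c_pos: "c > 0" and b_eq_c: "\<exists>\<^sub>\<infinity>k. b k = c"
begin

text \<open>The negative of the derivative of \<open>psum m\<close> below.\<close>

definition slope :: "nat \<Rightarrow> real \<Rightarrow> real" where
  "slope m x = (\<Sum>k<m. b k * sin (x / r k))"

definition psum :: "nat \<Rightarrow> real \<Rightarrow> real" where
  "psum m x = (\<Sum>k<m. b k * r k * cos (x / r k))"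

definition series :: "real \<Rightarrow> real" where
  "series x = (\<Sum>k. b k * r k * cos (x / r k))"

lemma r_nonzero [simp]: "r k \<noteq> 0"
  using r_pos[of k] by simp

lemma c_le_1: "c \<le> 1"
proof -
  obtain k where "b k = c" using frequently_ex[OF b_eq_c] by auto
  then show ?thesis using b01[of k] by simp
qed

lemma r_Suc_le_half: "r (Suc k) \<le> r k / 2"
proof -
  have "r k * (1/2) ^ Suc k \<le> r k * (1/2)"
    using r_pos[of k] power_le_one[of "1/2::real" k] by (intro mult_left_mono) auto
  then show ?thesis using ratio[of k] by simp
qed

lemma r_add_le: "r (m + i) \<le> r m * (1/2) ^ i"
proof (induction i)
  case (Suc i)
  then show ?case using r_Suc_le_half[of "m + i"] by simp
qed simp

lemma sum_inverse_r_le: "(\<Sum>k<Suc m. 1 / r k) \<le> 2 / r m"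
proof (induction m)
  case (Suc m)
  have "2 / r m \<le> 1 / r (Suc m)"
    using r_Suc_le_half[of m] r_pos[of m] r_pos[of "Suc m"] by (simp add: field_simps)
  then show ?case using Suc unfolding sum.lessThan_Suc[of _ "Suc m"] by linarith
qed (use r_pos[of 0] in \<open>simp add: field_simps\<close>)

lemma norm_term_le: "norm (b k * r k * cos (x / r k)) \<le> r k"
proof -
  have "b k * r k * \<bar>cos (x / r k)\<bar> \<le> 1 * r k * 1"
    using b01[of k] r_pos[of k] by (intro mult_mono) auto
  then show ?thesis using b01[of k] r_pos[of k] by (simp add: abs_mult)
qed

lemma abs_series_minus_psum_le: "\<bar>series x - psum m x\<bar> \<le> 2 * r m"
proof -
  define f where "f k = b k * r k * cos (x / r k)" for k
  have g: "(\<lambda>i. r m * (1/2) ^ i) sums (r m * (1 / (1 - 1/2)))"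
    by (intro sums_mult geometric_sums) simp
  have le: "norm (f (i + m)) \<le> r m * (1/2) ^ i" for i
    using norm_term_le[of "i + m" x] r_add_le[of m i] by (simp add: f_def add.commute)
  have "summable (\<lambda>i. f (i + m))"
    by (rule summable_comparison_test'[OF sums_summable[OF g], of 0]) (use le in auto)
  then have "summable f" by (simp add: summable_iff_shift)
  then have "series x - psum m x = (\<Sum>i. f (i + m))"
    unfolding series_def psum_def f_def[symmetric] by (subst suminf_split_initial_segment[of _ m]) auto
  moreover have "norm (\<Sum>i. f (i + m)) \<le> (\<Sum>i. r m * (1/2) ^ i)"
    by (rule norm_suminf_le[OF le sums_summable[OF g]])
  ultimately show ?thesis using sums_unique[OF g] by simp
qed

lemma slope_lipschitz: "\<bar>slope (Suc m) x - slope (Suc m) y\<bar> \<le> 2 / r m * \<bar>x - y\<bar>"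
proof -
  have sin_lip: "\<bar>sin s - sin t\<bar> \<le> \<bar>s - t\<bar>" for s t :: real
  proof -
    have "\<bar>sin s - sin t\<bar> = 2 * \<bar>sin ((s - t) / 2)\<bar> * \<bar>cos ((s + t) / 2)\<bar>"
      by (simp add: sin_diff_sin abs_mult)
    also have "\<dots> \<le> 2 * \<bar>(s - t) / 2\<bar> * 1"
      by (intro mult_mono abs_sin_x_le_abs_x) auto
    finally show ?thesis by simp
  qed
  have "\<bar>slope (Suc m) x - slope (Suc m) y\<bar> \<le> (\<Sum>k<Suc m. \<bar>b k * sin (x / r k) - b k * sin (y / r k)\<bar>)"
    unfolding slope_def sum_subtractf[symmetric] by (rule sum_abs)
  also have "\<dots> \<le> (\<Sum>k<Suc m. 1 / r k * \<bar>x - y\<bar>)"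
  proof (rule sum_mono)
    fix k
    have "\<bar>b k * sin (x / r k) - b k * sin (y / r k)\<bar> = b k * \<bar>sin (x / r k) - sin (y / r k)\<bar>"
      using b01[of k] by (simp add: abs_mult right_diff_distrib[symmetric])
    also have "\<dots> \<le> 1 * \<bar>x / r k - y / r k\<bar>"
      using b01[of k] by (intro mult_mono sin_lip) auto
    also have "\<dots> = 1 / r k * \<bar>x - y\<bar>"
      using r_pos[of k] by (simp add: diff_divide_distrib[symmetric])
    finally show "\<bar>b k * sin (x / r k) - b k * sin (y / r k)\<bar> \<le> 1 / r k * \<bar>x - y\<bar>" .
  qed
  also have "\<dots> \<le> 2 / r m * \<bar>x - y\<bar>"
    unfolding sum_distrib_right[symmetric] by (intro mult_right_mono sum_inverse_r_le) auto
  finally show ?thesis .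
qed

lemma slope_continuous: "continuous_on S (slope m)"
  unfolding slope_def by (intro continuous_intros) auto

lemma psum_deriv: "(psum m has_real_derivative - slope m x) (at x)"
proof -
  have "((\<lambda>x. b k * r k * cos (x / r k)) has_real_derivative - (b k * sin (x / r k))) (at x)" for k
    using r_pos[of k] by (auto intro!: derivative_eq_intros)
  then show ?thesis
    unfolding psum_def slope_def sum_negf[symmetric] by (intro DERIV_sum)
qed

text \<open>By the mean value theorem the increment is \<open>h\<close> times the slope at some point, and the slope varies by at
  most \<open>2 * h / r m\<close> on the interval.\<close>

lemma integral_abs_slope_le_increment:
  assumes "h > 0"
  shows "integral {x..x+h} (\<lambda>t. \<bar>slope (Suc m) t\<bar>) \<le> \<bar>psum (Suc m) (x + h) - psum (Suc m) x\<bar> + 2 / r m * h\<^sup>2"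
proof -
  obtain z where z: "x < z" "z < x + h" "psum (Suc m) (x + h) - psum (Suc m) x = h * - slope (Suc m) z"
    using MVT2[of x "x + h" "psum (Suc m)" "\<lambda>x. - slope (Suc m) x"] psum_deriv \<open>h > 0\<close> by auto
  have "norm (integral {x..x+h} (\<lambda>t. \<bar>slope (Suc m) t\<bar>)) \<le> (\<bar>slope (Suc m) z\<bar> + 2 / r m * h) * (x + h - x)"
  proof (intro integral_bound continuous_intros slope_continuous)
    fix t assume t: "t \<in> {x..x+h}"
    have "\<bar>slope (Suc m) t - slope (Suc m) z\<bar> \<le> 2 / r m * \<bar>t - z\<bar>" by (rule slope_lipschitz)
    also have "\<dots> \<le> 2 / r m * h"
      using t z r_pos[of m] by (intro mult_left_mono) auto
    finally show "norm \<bar>slope (Suc m) t\<bar> \<le> \<bar>slope (Suc m) z\<bar> + 2 / r m * h" by simp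
  qed (use \<open>h > 0\<close> in auto)
  then show ?thesis
    using \<open>h > 0\<close> unfolding z(3) by (simp add: abs_mult power2_eq_square algebra_simps)
qed

text \<open>The variation of the full series over a grid controls the integral of the partial slope. For
  a mesh \<open>h\<close> of size \<open>r m\<close> the accumulated error is bounded independently of \<open>m\<close>.\<close>

lemma integral_abs_slope_le_sum:
  assumes "h > 0"
  shows "integral {x..x + real n * h} (\<lambda>t. \<bar>slope (Suc m) t\<bar>)
    \<le> (\<Sum>i<n. \<bar>series (x + real (Suc i) * h) - series (x + real i * h)\<bar>)
       + real n * (2 / r m * h\<^sup>2 + 4 * r (Suc m))"
proof (induction n)
  case (Suc n)
  have "integral {x..x + real (Suc n) * h} (\<lambda>t. \<bar>slope (Suc m) t\<bar>)
     = integral {x..x + real n * h} (\<lambda>t. \<bar>slope (Suc m) t\<bar>)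
       + integral {x + real n * h..x + real (Suc n) * h} (\<lambda>t. \<bar>slope (Suc m) t\<bar>)"
    using \<open>h > 0\<close>
    by (intro Henstock_Kurzweil_Integration.integral_combine[symmetric] integrable_continuous_real continuous_intros slope_continuous)
       (auto simp: algebra_simps)
  moreover have "integral {x + real n * h..x + real (Suc n) * h} (\<lambda>t. \<bar>slope (Suc m) t\<bar>)
     \<le> \<bar>psum (Suc m) (x + real (Suc n) * h) - psum (Suc m) (x + real n * h)\<bar> + 2 / r m * h\<^sup>2"
    using integral_abs_slope_le_increment[OF assms, of "x + real n * h" m] by (simp add: algebra_simps)
  moreover have "\<bar>psum (Suc m) (x + real (Suc n) * h) - psum (Suc m) (x + real n * h)\<bar>
     \<le> \<bar>series (x + real (Suc n) * h) - series (x + real n * h)\<bar> + 4 * r (Suc m)"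
    using abs_series_minus_psum_le[of "x + real (Suc n) * h" "Suc m"]
      abs_series_minus_psum_le[of "x + real n * h" "Suc m"] by linarith
  ultimately have "integral {x..x + real (Suc n) * h} (\<lambda>t. \<bar>slope (Suc m) t\<bar>)
    \<le> (\<Sum>i<n. \<bar>series (x + real (Suc i) * h) - series (x + real i * h)\<bar>)
      + real n * (2 / r m * h\<^sup>2 + 4 * r (Suc m))
      + \<bar>series (x + real (Suc n) * h) - series (x + real n * h)\<bar> + 4 * r (Suc m) + 2 / r m * h\<^sup>2"
    using Suc by linarith
  moreover have "real (Suc n) * (2 / r m * h\<^sup>2 + 4 * r (Suc m))
    = real n * (2 / r m * h\<^sup>2 + 4 * r (Suc m)) + 4 * r (Suc m) + 2 / r m * h\<^sup>2"
    unfolding of_nat_Suc by (simp only: distrib_right mult_1_left add.commute add.left_commute)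
  ultimately show ?case unfolding sum.lessThan_Suc by linarith
qed simp

text \<open>Up to normalisation, the characteristic function at \<open>\<tau>\<close> of the slope as a random variable on \<open>[x, y]\<close>.\<close>

definition osc :: "real \<Rightarrow> real \<Rightarrow> real \<Rightarrow> nat \<Rightarrow> complex" where
  "osc \<tau> x y m = integral {x..y} (\<lambda>t. cis (\<tau> * slope m t))"

text \<open>The slope gains the summand \<open>b (Suc m) * sin (t / r (Suc m))\<close>, which oscillates fast compared with \<open>r m\<close>; its
  exponential averages out to the factor \<open>q\<close>.\<close>

lemma osc_step:
  assumes "x \<le> y" "0 \<le> \<tau>"
    and q: "q = integral {0..2*pi} (\<lambda>\<theta>. cis (\<tau> * b (Suc m) * sin \<theta>)) / (2*pi)"
  shows "norm (osc \<tau> x y (Suc (Suc m)) - q * osc \<tau> x y (Suc m))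
    \<le> 8 * pi * (r 0 + \<tau> * (y - x)) * (1/2) ^ m"
proof -
  define F where "F t = cis (\<tau> * slope (Suc m) t)" for t
  define s where "s t = (\<Sum>k<Suc m. b k * (cos (t / r k) / r k))" for t
  define F' where "F' t = (\<tau> * s t) *\<^sub>R (\<i> * F t)" for t
  have sd: "(slope (Suc m) has_real_derivative s t) (at t)" for t
  proof -
    have "((\<lambda>x. b k * sin (x / r k)) has_real_derivative b k * (cos (t / r k) / r k)) (at t)" for k
      by (auto intro!: derivative_eq_intros)
    then show ?thesis unfolding slope_def s_def by (intro DERIV_sum)
  qed
  have Fd: "(F has_vector_derivative F' t) (at t)" for t
  proof -
    have "((\<lambda>t. \<tau> * slope (Suc m) t) has_vector_derivative \<tau> * s t) (at t)"
      unfolding has_real_derivative_iff_has_vector_derivative[symmetric]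
      by (auto intro!: derivative_eq_intros sd)
    from has_derivative_cis[OF this[unfolded has_vector_derivative_def]]
    show ?thesis unfolding has_vector_derivative_def F_def[abs_def] F'_def F_def
      by (simp add: mult_ac)
  qed
  have s_le: "\<bar>s t\<bar> \<le> 2 / r m" for t
  proof -
    have "\<bar>s t\<bar> \<le> (\<Sum>k<Suc m. \<bar>b k * (cos (t / r k) / r k)\<bar>)"
      unfolding s_def by (rule sum_abs)
    also have "\<dots> \<le> (\<Sum>k<Suc m. 1 / r k)"
    proof (rule sum_mono)
      fix k
      have "b k * \<bar>cos (t / r k)\<bar> \<le> 1 * 1" using b01[of k] by (intro mult_mono) auto
      then show "\<bar>b k * (cos (t / r k) / r k)\<bar> \<le> 1 / r k"
        using b01[of k] r_pos[of k] by (simp add: abs_mult field_simps)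
    qed
    finally show ?thesis using sum_inverse_r_le[of m] by linarith
  qed
  have "norm (integral {x..y} (\<lambda>t. F t * cis (\<tau> * b (Suc m) * sin (t / r (Suc m)))) - q * integral {x..y} F)
     \<le> 4 * pi * r (Suc m) * (2 + (\<tau> * (2 / r m)) * (y - x))"
  proof (rule integral_mult_oscillation[where F' = F'])
    have "continuous_on UNIV s"
      unfolding s_def by (intro continuous_intros) auto
    then show "continuous_on UNIV F'"
      unfolding F'_def F_def by (intro continuous_intros slope_continuous)
    show "norm (F' t) \<le> \<tau> * (2 / r m)" for t
      using mult_left_mono[OF s_le[of t] \<open>0 \<le> \<tau>\<close>] \<open>0 \<le> \<tau>\<close>
      by (simp add: F'_def F_def norm_mult abs_mult)
    show "norm (F t) \<le> 1" for t by (simp add: F_def)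
  qed (use assms r_pos Fd in \<open>auto intro!: continuous_intros\<close>)
  moreover have "F t * cis (\<tau> * b (Suc m) * sin (t / r (Suc m))) = cis (\<tau> * slope (Suc (Suc m)) t)" for t
    by (simp add: F_def cis_mult slope_def algebra_simps)
  ultimately have "norm (osc \<tau> x y (Suc (Suc m)) - q * osc \<tau> x y (Suc m))
     \<le> 4 * pi * r (Suc m) * (2 + (\<tau> * (2 / r m)) * (y - x))"
    by (simp add: osc_def F_def[abs_def])
  also have "\<dots> = 8 * pi * r (Suc m) + 8 * pi * \<tau> * (y - x) * (r (Suc m) / r m)"
    by (simp add: algebra_simps diff_divide_distrib)
  also have "\<dots> \<le> 8 * pi * (r 0 * (1/2)^m) + 8 * pi * \<tau> * (y - x) * (1/2) ^ m"
  proof (intro add_mono mult_left_mono)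
    show "r (Suc m) \<le> r 0 * (1/2)^m"
      using r_add_le[of 0 m] r_Suc_le_half[of m] r_pos[of m] by simp
    have "r (Suc m) / r m \<le> (1/2) ^ Suc m"
      using ratio[of m] r_pos[of m] by (simp add: field_simps)
    then show "r (Suc m) / r m \<le> (1/2) ^ m"
      by (rule order_trans) simp
  qed (use assms in auto)
  finally show ?thesis by (simp add: algebra_simps)
qed

lemma osc_tendsto_0:
  assumes "x \<le> y" "0 < \<tau>" "\<tau> \<le> 1"
  shows "(\<lambda>m. osc \<tau> x y (Suc m)) \<longlonglongrightarrow> 0"
proof -
  define q where "q d = integral {0..2*pi} (\<lambda>\<theta>. cis (\<tau> * d * sin \<theta>)) / (2*pi)" for d
  have q1: "norm (q d) \<le> 1" for d
  proof -
    have "norm (integral {0..2*pi} (\<lambda>\<theta>. cis (\<tau> * d * sin \<theta>))) \<le> 1 * (2*pi - 0)"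
      by (intro integral_bound continuous_intros) auto
    then show ?thesis by (simp add: q_def norm_divide field_simps)
  qed
  have "\<tau> * c \<le> 1 * 1" using c_le_1 c_pos assms by (intro mult_mono) auto
  then have qc: "norm (q c) < 1"
    unfolding q_def using assms c_pos pi_gt3 by (intro norm_mean_cis_sin_less_1) auto
  have "(\<lambda>m. norm (osc \<tau> x y (Suc m))) \<longlonglongrightarrow> 0"
  proof (rule contraction_infinitely_often_tendsto_0[OF _ _ _ _ qc])
    show "norm (osc \<tau> x y (Suc (Suc m))) \<le> norm (q (b (Suc m))) * norm (osc \<tau> x y (Suc m))
        + 8 * pi * (r 0 + \<tau> * (y - x)) * (1/2) ^ m" for m
      using osc_step[OF assms(1) less_imp_le[OF assms(2)] q_def, of m]
        norm_triangle_sub[of "osc \<tau> x y (Suc (Suc m))" "q (b (Suc m)) * osc \<tau> x y (Suc m)"]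
      by (simp add: norm_mult)
    show "\<exists>\<^sub>\<infinity>m. norm (q (b (Suc m))) = norm (q c)"
    proof -
      have "\<exists>\<^sub>\<infinity>m. b (Suc m) = c"
        using b_eq_c unfolding cofinite_eq_sequentially frequently_def
        by (simp add: eventually_sequentially_Suc[of "\<lambda>m. b m \<noteq> c"])
      then show ?thesis by (rule frequently_elim1) simp
    qed
  qed (use q1 in auto)
  then show ?thesis by (rule tendsto_norm_zero_cancel)
qed

text \<open>If all grid sums were at most \<open>V\<close>, the slopes would be bounded in mean, so for small \<open>\<tau>\<close> the integrals
  \<open>osc \<tau> x y\<close> could not tend to \<open>0\<close>.\<close>

theorem series_unbounded_variation:
  assumes "x < y"
  shows "\<exists>n>0. (\<Sum>i<n. \<bar>series (x + real (Suc i) * ((y - x) / n)) - series (x + real i * ((y - x) / n))\<bar>) > V"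
proof (rule ccontr)
  assume "\<not> ?thesis"
  then have V: "(\<Sum>i<n. \<bar>series (x + real (Suc i) * ((y - x) / n)) - series (x + real i * ((y - x) / n))\<bar>) \<le> V"
    if "n > 0" for n using that by (meson linorder_not_less)
  have "V \<ge> 0" using order_trans[OF sum_nonneg V[of 1]] by simp
  define d where "d = y - x"
  have "d > 0" using assms by (simp add: d_def)
  define M where "M = V + 4 * d + 4 * d + 4 * r 0"
  have "M > 0" "d \<le> M" using \<open>V \<ge> 0\<close> \<open>d > 0\<close> r_pos[of 0] by (auto simp: M_def)
  have intM: "integral {x..y} (\<lambda>t. \<bar>slope (Suc m) t\<bar>) \<le> M" for m
  proof -
    \<comment> \<open>the mesh is just below the finest wavelength of the partial sum\<close>
    define n where "n = nat \<lceil>d / r m\<rceil>"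
    define h where "h = d / n"
    have n: "d / r m \<le> n" "n \<le> d / r m + 1" "n > 0"
      using \<open>d > 0\<close> r_pos[of m] unfolding n_def by auto
    have h: "h > 0" "h \<le> r m" "n * h = d"
      using n \<open>d > 0\<close> r_pos[of m] by (auto simp: h_def field_simps)
    have "integral {x..y} (\<lambda>t. \<bar>slope (Suc m) t\<bar>) \<le> V + real n * (2 / r m * h\<^sup>2 + 4 * r (Suc m))"
      using integral_abs_slope_le_sum[OF h(1), of x n m] V[OF n(3)] h(3)
      by (simp add: d_def h_def)
    also have "real n * (2 / r m * h\<^sup>2 + 4 * r (Suc m)) = 2 * d * (h / r m) + 4 * (n * r (Suc m))"
      using h(3) by (simp add: power2_eq_square algebra_simps)
    also have "\<dots> \<le> 2 * d * 1 + 4 * (d + r 0)"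
    proof (intro add_mono mult_left_mono)
      have "n * r (Suc m) \<le> (d / r m + 1) * r m"
        using n r_Suc_le_half[of m] r_pos[of m] r_pos[of "Suc m"] \<open>d > 0\<close> by (intro mult_mono) auto
      also have "\<dots> = d + r m" using r_pos[of m] by (simp add: field_simps)
      also have "r m \<le> r 0 * (1/2) ^ m" using r_add_le[of 0 m] by simp
      also have "\<dots> \<le> r 0 * 1"
        using r_pos[of 0] by (intro mult_left_mono power_le_one) auto
      finally show "n * r (Suc m) \<le> d + r 0" by simp
    qed (use h r_pos \<open>d > 0\<close> in auto)
    finally show ?thesis using \<open>d > 0\<close> by (simp add: M_def)
  qed
  define \<tau> where "\<tau> = d / (2 * M)"
  have \<tau>: "0 < \<tau>" "\<tau> \<le> 1" using \<open>d > 0\<close> \<open>M > 0\<close> \<open>d \<le> M\<close> by (auto simp: \<tau>_def field_simps)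
  have lower: "norm (osc \<tau> x y (Suc m)) \<ge> d / 2" for m
  proof -
    let ?g = "\<lambda>t. cis (\<tau> * slope (Suc m) t)"
    have int: "?g integrable_on {x..y}"
      by (intro integrable_continuous_real continuous_intros slope_continuous)
    have "osc \<tau> x y (Suc m) - of_real d = integral {x..y} (\<lambda>t. ?g t - 1)"
      using assms by (subst integral_diff[OF int]) (auto simp: osc_def d_def scaleR_conv_of_real)
    moreover have "norm (integral {x..y} (\<lambda>t. ?g t - 1)) \<le> integral {x..y} (\<lambda>t. \<tau> * \<bar>slope (Suc m) t\<bar>)"
    proof (rule integral_norm_bound_integral)
      show "norm (?g t - 1) \<le> \<tau> * \<bar>slope (Suc m) t\<bar>" for t
        using norm_cis_diff_1_le[of "\<tau> * slope (Suc m) t"] \<tau> by (simp add: abs_mult)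
    qed (intro integrable_continuous_real continuous_intros slope_continuous)+
    moreover have "\<dots> \<le> \<tau> * M" using intM[of m] \<tau> by (simp add: mult_left_mono)
    moreover have "\<tau> * M = d / 2" using \<open>M > 0\<close> by (simp add: \<tau>_def)
    ultimately have "norm (osc \<tau> x y (Suc m) - of_real d) \<le> d / 2" by simp
    moreover have "norm (of_real d :: complex) = d" using \<open>d > 0\<close> by simp
    ultimately show ?thesis
      using norm_triangle_ineq2[of "of_real d" "osc \<tau> x y (Suc m)"] by (simp add: norm_minus_commute)
  qed
  have "(\<lambda>m. norm (osc \<tau> x y (Suc m))) \<longlonglongrightarrow> 0"
    using osc_tendsto_0[of x y \<tau>] \<tau> assms by (intro tendsto_norm_zero) auto
  then have "0 \<ge> d / 2" by (rule LIMSEQ_le_const) (use lower in auto)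
  then show False using \<open>d > 0\<close> by simp
qed

end

text \<open>The parameter of an arc may traverse the line backwards; since the series is even, a reflection reduces
  this to the previous case.\<close>

lemma (in lacunary_cosine_series) series_unbounded_variation_either_direction:
  assumes "x \<noteq> y"
  shows "\<exists>n>0. (\<Sum>i<n. \<bar>series (x + real (Suc i) * ((y - x) / n)) - series (x + real i * ((y - x) / n))\<bar>) > V"
proof (cases "x < y")
  case True
  then show ?thesis by (rule series_unbounded_variation)
next
  case False
  have even: "series (- t) = series t" for t by (simp add: series_def)
  have eq: "series (- x + real i * ((- y - - x) / n)) = series (x + real i * ((y - x) / n))" for i n :: nat
    using even[of "x + real i * ((y - x) / n)"] by (simp add: minus_divide_left algebra_simps)
  have "- x < - y" using False assms by simp
  from series_unbounded_variation[OF this, of V, unfolded eq] show ?thesis .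
qed

section \<open>Maps with controlled Wirtinger derivatives\<close>

text \<open>The real linear map of \<open>\<complex>\<close> whose derivatives with respect to \<open>z\<close> and \<open>cnj z\<close> are \<open>p\<close> and \<open>q\<close>.\<close>

definition wirtinger :: "complex \<Rightarrow> complex \<Rightarrow> complex \<Rightarrow> complex" where
  "wirtinger p q w = p * w + q * cnj w"

text \<open>The derivative in direction \<open>v\<close>, paired with \<open>v\<close>, is \<open>Re p * |v|\<^sup>2 + Re (q * cnj v ^ 2)\<close>; the imaginary part of
  \<open>p\<close>, which may be arbitrarily large, only rotates \<open>v\<close> by a right angle.\<close>

lemma strongly_monotone_of_wirtinger:
  assumes f: "\<And>z. (f has_derivative wirtinger (p z) (q z)) (at z)"
    and p: "\<And>z. Re (p z) = 1" and q: "\<And>z. norm (q z) \<le> 1/3"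
  shows "Re ((f a - f b) * cnj (a - b)) \<ge> 2/3 * (norm (a - b))\<^sup>2"
proof -
  define v where "v = a - b"
  define \<phi> where "\<phi> t = Re (f (b + of_real t * v) * cnj v)" for t :: real
  have deriv: "(\<phi> has_real_derivative Re (wirtinger (p (b + of_real t * v)) (q (b + of_real t * v)) v * cnj v)) (at t)" for t
  proof -
    have "((\<lambda>t. b + of_real t * v) has_derivative (\<lambda>h. of_real h * v)) (at t)"
      by (auto intro!: derivative_eq_intros)
    from has_derivative_compose[OF this f]
    have "((\<lambda>t. f (b + of_real t * v)) has_derivative
        (\<lambda>h. wirtinger (p (b + of_real t * v)) (q (b + of_real t * v)) (of_real h * v))) (at t)" .
    then have "(\<phi> has_derivative (\<lambda>h. Re (wirtinger (p (b + of_real t * v)) (q (b + of_real t * v)) (of_real h * v) * cnj v))) (at t)"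
      unfolding \<phi>_def by (intro derivative_intros)
    moreover have "Re (wirtinger (p (b + of_real t * v)) (q (b + of_real t * v)) (of_real h * v) * cnj v)
       = Re (wirtinger (p (b + of_real t * v)) (q (b + of_real t * v)) v * cnj v) * h" for h
      by (simp add: wirtinger_def algebra_simps)
    ultimately show ?thesis by (simp add: has_field_derivative_def)
  qed
  have lower: "Re (wirtinger (p z) (q z) v * cnj v) \<ge> 2/3 * (norm v)\<^sup>2" for z
  proof -
    have "wirtinger (p z) (q z) v * cnj v = p z * of_real ((norm v)\<^sup>2) + q z * (cnj v)\<^sup>2"
      unfolding complex_norm_square wirtinger_def by (simp add: power2_eq_square algebra_simps)
    then have "Re (wirtinger (p z) (q z) v * cnj v) = (norm v)\<^sup>2 + Re (q z * (cnj v)\<^sup>2)"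
      using p[of z] by simp
    moreover have "\<bar>Re (q z * (cnj v)\<^sup>2)\<bar> \<le> norm (q z) * (norm v)\<^sup>2"
      using abs_Re_le_cmod[of "q z * (cnj v)\<^sup>2"] by (simp add: norm_mult norm_power)
    moreover have "norm (q z) * (norm v)\<^sup>2 \<le> 1/3 * (norm v)\<^sup>2"
      using q by (intro mult_right_mono) auto
    ultimately show ?thesis by linarith
  qed
  obtain t where "\<phi> 1 - \<phi> 0 = (1 - 0) * Re (wirtinger (p (b + of_real t * v)) (q (b + of_real t * v)) v * cnj v)"
    using MVT2[of 0 1 \<phi>] deriv by fastforce
  then have "\<phi> 1 - \<phi> 0 \<ge> 2/3 * (norm v)\<^sup>2" using lower by simp
  moreover have "\<phi> 1 - \<phi> 0 = Re ((f a - f b) * cnj v)"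
    by (simp add: \<phi>_def v_def left_diff_distrib del: times_complex.simps complex_cnj_diff)
  ultimately show ?thesis by (simp add: v_def)
qed

text \<open>Strong monotonicity makes the inverse Lipschitz. Hence the range is complete, and by invariance of domain
  it is open.\<close>

lemma strongly_monotone_homeomorphism:
  fixes f :: "complex \<Rightarrow> complex"
  assumes cont: "continuous_on UNIV f" and "c > 0"
    and mono: "\<And>a b. Re ((f a - f b) * cnj (a - b)) \<ge> c * (norm (a - b))\<^sup>2"
  shows "\<exists>g. homeomorphism UNIV UNIV f g"
proof -
  have exp: "c * norm (a - b) \<le> norm (f a - f b)" for a b
  proof (cases "a = b")
    case False
    have "c * (norm (a - b))\<^sup>2 \<le> norm (f a - f b) * norm (a - b)"
      using order_trans[OF mono[of a b] complex_Re_le_cmod] by (simp only: norm_mult complex_mod_cnj)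
    then show ?thesis using False by (simp add: power2_eq_square)
  qed simp
  have inj: "inj f"
  proof (rule injI)
    fix a b assume "f a = f b"
    then show "a = b" using exp[of a b] \<open>c > 0\<close> by (simp add: mult_le_0_iff)
  qed
  have "open (range f)"
    by (rule invariance_of_domain[OF cont open_UNIV inj])
  moreover have "closed (range f)"
    unfolding closed_sequential_limits
  proof (intro allI impI, elim conjE)
    fix y l assume "\<forall>n. y n \<in> range f" and lim: "y \<longlonglongrightarrow> l"
    then have "\<forall>n. \<exists>x. y n = f x" by blast
    then obtain x where x: "\<And>n. y n = f (x n)" by metis
    have "Cauchy x"
    proof (rule metric_CauchyI)
      fix e :: real assume "e > 0"
      then obtain M where M: "\<And>m n. m \<ge> M \<Longrightarrow> n \<ge> M \<Longrightarrow> dist (y m) (y n) < c * e"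
        using metric_CauchyD[OF LIMSEQ_imp_Cauchy[OF lim], of "c * e"] \<open>c > 0\<close> by auto
      have "dist (x m) (x n) < e" if "m \<ge> M" "n \<ge> M" for m n
      proof -
        have "c * dist (x m) (x n) < c * e"
          using M[OF that] exp[of "x m" "x n"] unfolding x dist_norm by linarith
        then show ?thesis using \<open>c > 0\<close> by simp
      qed
      then show "\<exists>M. \<forall>m\<ge>M. \<forall>n\<ge>M. dist (x m) (x n) < e" by blast
    qed
    then obtain a where "x \<longlonglongrightarrow> a" by (auto simp: Cauchy_convergent_iff convergent_def)
    then have "(\<lambda>n. f (x n)) \<longlonglongrightarrow> f a"
      using continuous_on_tendsto_compose[OF cont] by simp
    then have "y \<longlonglongrightarrow> f a" by (simp add: x[symmetric])
    then have "l = f a" by (rule LIMSEQ_unique[OF lim])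
    then show "l \<in> range f" by (rule range_eqI)
  qed
  ultimately have surj: "range f = UNIV"
    using clopen[of "range f"] by blast
  show ?thesis
    using invariance_of_domain_homeomorphism[OF open_UNIV cont _ inj] unfolding surj by blast
qed

text \<open>The matrix has operator norm at most \<open>|p| + |q|\<close> and determinant \<open>|p|\<^sup>2 - |q|\<^sup>2\<close>, and \<open>|q| \<le> |p| / 3\<close>.\<close>

lemma distortion_le_of_wirtinger:
  assumes "Re p = 1" "norm q \<le> 1/3"
  shows "(onorm ((*v) (differential_matrix (p + q) (\<i> * (p - q)))))\<^sup>2
     \<le> 2 * det (differential_matrix (p + q) (\<i> * (p - q)))"
proof -
  let ?A = "differential_matrix (p + q) (\<i> * (p - q))"
  have p1: "norm p \<ge> 1" using complex_Re_le_cmod[of p] assms by simp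
  have det: "det ?A = (norm p)\<^sup>2 - (norm q)\<^sup>2"
    unfolding cmod_power2
    by (simp add: det_2 differential_matrix_def) (simp add: power2_eq_square algebra_simps)
  have "norm (?A *v x) \<le> (norm p + norm q) * norm x" for x
  proof -
    define w where "w = Complex (x$1) (x$2)"
    have n: "norm y = norm (Complex (y$1) (y$2))" for y :: "real^2"
      by (simp add: norm_vec_def L2_set_def sum_2 cmod_def)
    have "Complex ((?A *v x) $ 1) ((?A *v x) $ 2) = p * w + q * cnj w"
      by (simp add: complex_eq_iff w_def differential_matrix_def matrix_vector_mult_def sum_2 algebra_simps)
    then have "norm (?A *v x) = norm (p * w + q * cnj w)" using n[of "?A *v x"] by simp
    also have "\<dots> \<le> (norm p + norm q) * norm w"
      using norm_triangle_ineq[of "p * w" "q * cnj w"] by (simp add: norm_mult algebra_simps)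
    finally show ?thesis using n[of x] by (simp add: w_def)
  qed
  then have "onorm ((*v) ?A) \<le> norm p + norm q" by (intro onorm_le)
  moreover have "onorm ((*v) ?A) \<ge> 0" by (intro onorm_pos_le matrix_vector_mul_bounded_linear)
  ultimately have "(onorm ((*v) ?A))\<^sup>2 \<le> (norm p + norm q)\<^sup>2" by (intro power_mono)
  also have "\<dots> = (norm p + norm q) * (norm p + norm q)" by (simp add: power2_eq_square)
  also have "\<dots> \<le> (norm p + norm q) * (2 * (norm p - norm q))"
    using p1 assms(2) by (intro mult_left_mono) auto
  also have "\<dots> = 2 * det ?A" unfolding det by (simp add: power2_eq_square algebra_simps)
  finally show ?thesis .
qed

section \<open>Weak derivatives of limits of smooth maps\<close>

text \<open>Difference quotients have integral zero by translation invariance; they converge boundedly. This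
  works for every direction \<open>v\<close> without Fubini's theorem.\<close>

lemma integral_directional_derivative_eq_0:
  fixes u :: "complex \<Rightarrow> complex"
  assumes deriv: "\<And>z. (u has_derivative u' z) (at z)"
    and cont: "continuous_on UNIV (\<lambda>z. u' z v)"
    and supp: "\<And>z. z \<notin> cball 0 R \<Longrightarrow> u z = 0"
  shows "integrable lborel (\<lambda>z. u' z v)" and "integral\<^sup>L lborel (\<lambda>z. u' z v) = 0"
proof -
  have ucont: "continuous_on UNIV u"
    using deriv by (intro has_derivative_continuous_on) (auto intro: has_derivative_at_withinI)
  have u'0: "u' z v = 0" if "z \<notin> cball 0 R" for z
  proof -
    have "(u has_derivative (\<lambda>_. 0)) (at z)"
      by (rule has_derivative_transform_within_open[where f = "\<lambda>_. 0" and s = "- cball 0 R"])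
         (use that supp in auto)
    then have "u' z = (\<lambda>_. 0)" using has_derivative_unique deriv by blast
    then show ?thesis by simp
  qed
  have "bounded ((\<lambda>z. u' z v) ` cball 0 R)"
    by (intro compact_imp_bounded compact_continuous_image continuous_on_subset[OF cont]) auto
  then obtain B0 where "\<And>z. z \<in> cball 0 R \<Longrightarrow> norm (u' z v) \<le> B0"
    unfolding bounded_iff by blast
  then obtain B where B: "\<And>z. norm (u' z v) \<le> \<bar>B\<bar>"
    using u'0 by (metis abs_ge_self abs_ge_zero norm_zero order_trans)
  define t where "t n = 1 / real (Suc n)" for n
  have t: "0 < t n" "t n \<le> 1" for n by (simp_all add: t_def)
  have tlim: "t \<longlonglongrightarrow> 0"
    unfolding t_def inverse_eq_divide[symmetric] by (rule LIMSEQ_inverse_real_of_nat)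
  define d where "d n z = (1 / t n) *\<^sub>R (u (z + t n *\<^sub>R v) - u z)" for n z
  define w where "w z = indicator (cball 0 (R + norm v)) z *\<^sub>R \<bar>B\<bar>" for z :: complex
  have w: "integrable lborel w"
    unfolding w_def by (intro borel_integrable_compact) auto
  have path: "((\<lambda>s. u (z + s *\<^sub>R v)) has_derivative (\<lambda>h. u' (z + s *\<^sub>R v) (h *\<^sub>R v))) (at s)" for z and s :: real
  proof -
    have "((\<lambda>s. z + s *\<^sub>R v) has_derivative (\<lambda>h. h *\<^sub>R v)) (at s)"
      by (auto intro!: derivative_eq_intros)
    from has_derivative_compose[OF this deriv] show ?thesis .
  qed
  have lin: "u' z (h *\<^sub>R v) = h *\<^sub>R u' z v" for z and h :: real
    using linear_cmul[OF has_derivative_linear[OF deriv]] by blast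
  have dw: "norm (d n z) \<le> w z" for n z
  proof (cases "z \<in> cball 0 (R + norm v)")
    case True
    have "norm (u (z + t n *\<^sub>R v) - u (z + 0 *\<^sub>R v)) \<le> \<bar>B\<bar> * norm (t n - 0)"
    proof (rule differentiable_bound[where f = "\<lambda>s. u (z + s *\<^sub>R v)" and S = "{0..t n}"])
      show "onorm (\<lambda>h. u' (z + x *\<^sub>R v) (h *\<^sub>R v)) \<le> \<bar>B\<bar>" for x
        using B[of "z + x *\<^sub>R v"]
        by (intro onorm_le) (simp add: lin mult.commute[of "norm _"] mult_left_mono mult.commute)
    qed (use t[of n] path in \<open>auto intro: has_derivative_at_withinI\<close>)
    moreover have "norm (d n z) = norm (u (z + t n *\<^sub>R v) - u z) / t n"
      using t(1)[of n] by (simp add: d_def)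
    ultimately show ?thesis using t(1)[of n] True
      by (simp add: w_def divide_le_eq)
  next
    case False
    have "norm (z + t n *\<^sub>R v) \<ge> norm z - norm (t n *\<^sub>R v)"
      by (metis add.commute norm_diff_ineq)
    moreover have "norm (t n *\<^sub>R v) \<le> norm v" using t[of n] by (simp add: mult_left_le_one_le)
    ultimately have "z + t n *\<^sub>R v \<notin> cball 0 R" "z \<notin> cball 0 R"
      using False norm_ge_zero[of v] unfolding mem_cball_0 by linarith+
    then show ?thesis using supp False by (simp add: d_def w_def)
  qed
  have dlim: "(\<lambda>n. d n z) \<longlonglongrightarrow> u' z v" for z
  proof -
    have "((\<lambda>h. norm (u (z + h *\<^sub>R v) - u z - h *\<^sub>R u' z v) / norm h) \<longlongrightarrow> 0) (at 0)"
      using path[of z 0] unfolding has_derivative_at by (simp add: lin)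
    moreover have "filterlim t (at 0) sequentially"
      unfolding filterlim_at using tlim by (simp add: t_def)
    ultimately have "(\<lambda>n. norm (u (z + t n *\<^sub>R v) - u z - t n *\<^sub>R u' z v) / norm (t n)) \<longlonglongrightarrow> 0"
      by (rule filterlim_compose)
    moreover have "norm (u (z + t n *\<^sub>R v) - u z - t n *\<^sub>R u' z v) / norm (t n) = norm (d n z - u' z v)" for n
    proof -
      have "d n z - u' z v = (1 / t n) *\<^sub>R (u (z + t n *\<^sub>R v) - u z - t n *\<^sub>R u' z v)"
        using t(1)[of n] by (simp add: d_def scaleR_diff_right)
      then show ?thesis by simp
    qed
    ultimately have "(\<lambda>n. d n z - u' z v) \<longlonglongrightarrow> 0"
      by (simp add: tendsto_norm_zero_iff)
    then show ?thesis by (rule LIM_zero_cancel)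
  qed
  have meas: "(\<lambda>z. u' z v) \<in> borel_measurable lborel" "\<And>n. d n \<in> borel_measurable lborel"
    using cont ucont unfolding d_def
    by (auto intro!: borel_measurable_continuous_onI continuous_intros continuous_on_compose2[OF ucont])
  have uint: "integrable lborel u"
  proof -
    have "integrable lborel (\<lambda>x. indicator (cball 0 R) x *\<^sub>R u x)"
      by (intro borel_integrable_compact continuous_on_subset[OF ucont]) auto
    moreover have "(\<lambda>x. indicator (cball 0 R) x *\<^sub>R u x) = u"
      using supp by (auto simp: fun_eq_iff indicator_def)
    ultimately show ?thesis by simp
  qed
  have int0: "integral\<^sup>L lborel (d n) = 0" for n
  proof -
    have um: "u \<in> borel_measurable borel" using ucont by (rule borel_measurable_continuous_onI)
    have eq: "integral\<^sup>L lborel (\<lambda>z. u (t n *\<^sub>R v + z)) = integral\<^sup>L lborel u"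
      using integral_distr[of "(+) (t n *\<^sub>R v)" lborel borel u] um lborel_distr_plus[of "t n *\<^sub>R v"] by simp
    have "integrable lborel (\<lambda>z. u (t n *\<^sub>R v + z))"
      using integrable_distr[of "(+) (t n *\<^sub>R v)" lborel borel u] uint lborel_distr_plus[of "t n *\<^sub>R v"] by simp
    then show ?thesis
      unfolding d_def using uint eq by (simp add: add.commute[of _ "t n *\<^sub>R v"])
  qed
  show "integrable lborel (\<lambda>z. u' z v)"
    by (rule integrable_dominated_convergence[where s = d and w = w]) (use meas w dlim dw in auto)
  have "(\<lambda>n. integral\<^sup>L lborel (d n)) \<longlonglongrightarrow> integral\<^sup>L lborel (\<lambda>z. u' z v)"
    by (rule integral_dominated_convergence[where s = d and w = w]) (use meas w dlim dw in auto)
  then show "integral\<^sup>L lborel (\<lambda>z. u' z v) = 0"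
    by (simp add: int0 LIMSEQ_const_iff)
qed

lemma test_function_cball:
  assumes "test_function \<phi>"
  shows "\<exists>R. \<forall>z. z \<notin> cball 0 R \<longrightarrow> \<phi> z = 0"
proof -
  have "bounded {z. \<phi> z \<noteq> 0}"
    using assms unfolding test_function_def by (metis closure_subset compact_imp_bounded bounded_subset)
  then obtain R where "\<And>z. \<phi> z \<noteq> 0 \<Longrightarrow> norm z \<le> R" by (auto simp: bounded_iff)
  then show ?thesis by (intro exI[of _ R]) (force simp: mem_cball_0)
qed

lemma test_function_deriv:
  assumes "test_function \<phi>"
  shows "(\<phi> has_derivative frechet_derivative \<phi> (at z)) (at z)"
    and "continuous_on UNIV (\<lambda>z. frechet_derivative \<phi> (at z) v)"
    and "continuous_on UNIV \<phi>"
proof -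
  have "C_k (Suc 0) \<phi>" using assms unfolding test_function_def by blast
  then have d: "\<phi> differentiable_on UNIV" and "continuous_on UNIV (\<lambda>z. frechet_derivative \<phi> (at z) v)"
    by auto
  then show "(\<phi> has_derivative frechet_derivative \<phi> (at z)) (at z)"
     "continuous_on UNIV (\<lambda>z. frechet_derivative \<phi> (at z) v)"
    by (auto simp: differentiable_on_def frechet_derivative_works)
  show "continuous_on UNIV \<phi>" using d by (rule differentiable_imp_continuous_on)
qed

lemma test_function_integration_by_parts:
  fixes F :: "complex \<Rightarrow> complex"
  assumes \<phi>: "test_function \<phi>"
    and deriv: "\<And>z. (F has_derivative F' z) (at z)"
    and cont: "continuous_on UNIV (\<lambda>z. F' z v)"
  shows "integral\<^sup>L lborel (\<lambda>z. frechet_derivative \<phi> (at z) v *\<^sub>R F z)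
       = - integral\<^sup>L lborel (\<lambda>z. \<phi> z *\<^sub>R F' z v)"
proof -
  obtain R where R: "\<And>z. z \<notin> cball 0 R \<Longrightarrow> \<phi> z = 0" using test_function_cball[OF \<phi>] by blast
  note \<phi>' = test_function_deriv[OF \<phi>]
  have Fc: "continuous_on UNIV F"
    using deriv by (intro has_derivative_continuous_on) (auto intro: has_derivative_at_withinI)
  have d: "((\<lambda>z. \<phi> z *\<^sub>R F z) has_derivative
      (\<lambda>h. \<phi> z *\<^sub>R F' z h + frechet_derivative \<phi> (at z) h *\<^sub>R F z)) (at z)" for z
    by (intro has_derivative_scaleR \<phi>'(1) deriv)
  have c: "continuous_on UNIV (\<lambda>z. \<phi> z *\<^sub>R F' z v + frechet_derivative \<phi> (at z) v *\<^sub>R F z)"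
    by (intro continuous_intros \<phi>' cont Fc)
  have z: "z \<notin> cball 0 R \<Longrightarrow> \<phi> z *\<^sub>R F z = 0" for z using R[of z] by simp
  have "continuous_on (cball 0 R) (\<lambda>x. \<phi> x *\<^sub>R F' x v)"
    using continuous_on_scaleR[OF \<phi>'(3) cont] by (rule continuous_on_subset) simp
  note borel_integrable_compact[OF compact_cball this]
  moreover have "(\<lambda>x. indicator (cball 0 R) x *\<^sub>R (\<phi> x *\<^sub>R F' x v)) = (\<lambda>x. \<phi> x *\<^sub>R F' x v)"
    using R by (auto simp: fun_eq_iff indicator_def)
  ultimately have i1: "integrable lborel (\<lambda>x. \<phi> x *\<^sub>R F' x v)" by simp
  note i = integral_directional_derivative_eq_0[OF d c z]
  have i2: "integrable lborel (\<lambda>z. frechet_derivative \<phi> (at z) v *\<^sub>R F z)"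
    using Bochner_Integration.integrable_diff[OF i(1) i1] by simp
  show ?thesis
    using i(2) Bochner_Integration.integral_add[OF i1 i2] by (simp add: add_eq_0_iff)
qed

text \<open>Only the maps \<open>F n\<close> are differentiable in the classical sense. Strong monotonicity passes to the uniform limit, and integration by parts against a test function passes to the limit by
  dominated convergence with the locally integrable majorant \<open>H\<close> of \<open>|P n|\<^sup>2\<close>.\<close>

theorem quasiconformal_limit:
  fixes F P Q :: "nat \<Rightarrow> complex \<Rightarrow> complex" and H :: "complex \<Rightarrow> real"
  assumes deriv: "\<And>n z. (F n has_derivative wirtinger (P n z) (Q n z)) (at z)"
    and cont: "\<And>n. continuous_on UNIV (P n)" "\<And>n. continuous_on UNIV (Q n)"
    and P: "\<And>n z. Re (P n z) = 1" and Q: "\<And>n z. norm (Q n z) \<le> 1/3"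
    and unif: "\<And>n z. norm (F n z - f z) \<le> e n" and e: "e \<longlonglongrightarrow> 0"
    and conv: "AE z in lborel. convergent (\<lambda>n. P n z)" "AE z in lborel. convergent (\<lambda>n. Q n z)"
    and dom: "AE z in lborel. \<forall>n. (norm (P n z))\<^sup>2 \<le> H z"
    and H: "\<And>R. set_integrable lborel (cball 0 R) H"
  shows "quasiconformal f"
proof -
  have Fc: "continuous_on UNIV (F n)" for n
    using deriv[of n] by (intro has_derivative_continuous_on) (auto intro: has_derivative_at_withinI)
  have "uniform_limit UNIV F f sequentially"
    unfolding uniform_limit_iff
  proof (intro allI impI)
    fix d :: real assume "d > 0"
    then have "\<forall>\<^sub>F n in sequentially. e n < d" using order_tendstoD(2)[OF e] by blast
    then show "\<forall>\<^sub>F n in sequentially. \<forall>x\<in>UNIV. dist (F n x) (f x) < d"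
      by (rule eventually_mono) (auto simp: dist_norm intro: le_less_trans[OF unif])
  qed
  then have fc: "continuous_on UNIV f"
    by (rule uniform_limit_theorem[rotated]) (use Fc in auto)
  have Flim: "(\<lambda>n. F n z) \<longlonglongrightarrow> f z" for z
    by (rule LIM_zero_cancel, rule Lim_null_comparison[OF _ e]) (use unif in auto)
  have mono: "Re ((f a - f b) * cnj (a - b)) \<ge> 2/3 * (norm (a - b))\<^sup>2" for a b
  proof (rule LIMSEQ_le_const)
    show "(\<lambda>n. Re ((F n a - F n b) * cnj (a - b))) \<longlonglongrightarrow> Re ((f a - f b) * cnj (a - b))"
      by (intro tendsto_intros Flim)
  qed (use strongly_monotone_of_wirtinger[OF deriv P Q] in blast)
  have homeo: "\<exists>g. homeomorphism UNIV UNIV f g"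
    by (rule strongly_monotone_homeomorphism[OF fc _ mono]) simp

  define p where "p z = lim (\<lambda>n. P n z)" for z
  define q where "q z = lim (\<lambda>n. Q n z)" for z
  have [measurable]: "P n \<in> borel_measurable borel" "Q n \<in> borel_measurable borel"
     "F n \<in> borel_measurable borel" "f \<in> borel_measurable borel" for n
    using cont Fc fc by (auto intro: borel_measurable_continuous_onI)
  have [measurable]: "p \<in> borel_measurable borel" "q \<in> borel_measurable borel"
    unfolding p_def q_def by (rule borel_measurable_lim_metric; measurable)+
  have plim: "AE z in lborel. (\<lambda>n. P n z) \<longlonglongrightarrow> p z" and qlim: "AE z in lborel. (\<lambda>n. Q n z) \<longlonglongrightarrow> q z"
    using conv by (auto simp: p_def q_def convergent_LIMSEQ_iff)
  have p1: "AE z in lborel. Re (p z) = 1"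
    using plim
  proof eventually_elim
    case (elim z)
    from tendsto_Re[OF this] show ?case by (simp add: P LIMSEQ_const_iff)
  qed
  have q1: "AE z in lborel. norm (q z) \<le> 1/3"
    using qlim
  proof eventually_elim
    case (elim z)
    from tendsto_norm[OF this] show ?case by (rule LIMSEQ_le_const2) (use Q in auto)
  qed
  have pH: "AE z in lborel. (norm (p z))\<^sup>2 \<le> H z"
    using plim dom
  proof eventually_elim
    case (elim z)
    have "(\<lambda>n. (norm (P n z))\<^sup>2) \<longlonglongrightarrow> (norm (p z))\<^sup>2"
      by (intro tendsto_intros elim)
    then show ?case by (rule LIMSEQ_le_const2) (use elim in auto)
  qed
  have square: "(norm (s + t))\<^sup>2 \<le> 2 * h + 1"
    if "(norm s)\<^sup>2 \<le> h" "norm t \<le> 1/3" for s t :: complex and h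
  proof -
    have "(norm (s + t))\<^sup>2 \<le> (norm s + norm t)\<^sup>2"
      by (intro power_mono norm_triangle_ineq) auto
    also have "\<dots> \<le> 2 * (norm s)\<^sup>2 + 2 * (norm t)\<^sup>2"
      using sum_squares_bound[of "norm s" "norm t"] by (simp add: power2_sum)
    also have "(norm t)\<^sup>2 \<le> (1/3)\<^sup>2" using that by (intro power_mono) auto
    finally show ?thesis using that(1) by (simp add: power2_eq_square)
  qed
  have L2: "L2_loc g" if [measurable]: "g \<in> borel_measurable borel"
      and g: "AE z in lborel. (norm (g z))\<^sup>2 \<le> 2 * H z + 1" for g
    unfolding L2_loc_def
  proof (intro conjI allI impI)
    show "g \<in> borel_measurable lebesgue" using that(1) by (auto intro: measurable_completion)
    fix K :: "complex set" assume "compact K"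
    then obtain R where R: "K \<subseteq> cball 0 R"
      using bounded_subset_ballD[OF compact_imp_bounded, of K 0] ball_subset_cball by (meson order_trans)
    have [measurable]: "K \<in> sets borel" using \<open>compact K\<close> by (rule borel_compact)
    have i: "set_integrable lborel (cball 0 R) (\<lambda>z. 2 * H z + 1)"
      using H[of R] borel_integrable_compact[of "cball 0 R" "\<lambda>_::complex. 1::real"]
      by (intro set_integral_add) (auto simp: set_integrable_def mult.left_commute)
    have "set_integrable lborel K (\<lambda>z. (norm (g z))\<^sup>2)"
      unfolding set_integrable_def
    proof (rule Bochner_Integration.integrable_bound)
      show "integrable lborel (\<lambda>z. indicat_real (cball 0 R) z *\<^sub>R (2 * H z + 1))"
        using i by (simp add: set_integrable_def)
      show "AE z in lborel. norm (indicat_real K z *\<^sub>R (norm (g z))\<^sup>2)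
          \<le> norm (indicat_real (cball 0 R) z *\<^sub>R (2 * H z + 1))"
        using g by eventually_elim (use R in \<open>auto simp: indicator_def\<close>)
    qed measurable
    then show "set_integrable lebesgue K (\<lambda>z. (norm (g z))\<^sup>2)"
      unfolding set_integrable_def by (subst integrable_completion) (auto, measurable)
  qed
  have fL2: "L2_loc f"
    unfolding L2_loc_def
  proof (intro conjI allI impI)
    show "f \<in> borel_measurable lebesgue" by (auto intro: measurable_completion)
    fix K :: "complex set" assume "compact K"
    then have [measurable]: "K \<in> sets borel" by (rule borel_compact)
    have "set_integrable lborel K (\<lambda>z. (norm (f z))\<^sup>2)"
      unfolding set_integrable_def
      by (intro borel_integrable_compact \<open>compact K\<close> continuous_intros continuous_on_subset[OF fc]) auto
    then show "set_integrable lebesgue K (\<lambda>z. (norm (f z))\<^sup>2)"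
      unfolding set_integrable_def by (subst integrable_completion) (auto, measurable)
  qed
  have weak: "weak_derivative v f (\<lambda>z. wirtinger (p z) (q z) v)" for v
    unfolding weak_derivative_def
  proof (intro allI impI)
    fix \<phi> assume \<phi>: "test_function \<phi>"
    obtain R where R: "\<And>z. z \<notin> cball 0 R \<Longrightarrow> \<phi> z = 0" using test_function_cball[OF \<phi>] by blast
    define \<phi>' where "\<phi>' z = frechet_derivative \<phi> (at z) v" for z
    have cont\<phi>: "continuous_on UNIV \<phi>" "continuous_on UNIV \<phi>'"
      using test_function_deriv[OF \<phi>] by (auto simp: \<phi>'_def)
    then have [measurable]: "\<phi> \<in> borel_measurable borel" "\<phi>' \<in> borel_measurable borel"
      by (auto intro: borel_measurable_continuous_onI)
    have \<phi>'0: "\<phi>' z = 0" if "z \<notin> cball 0 R" for z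
    proof -
      have "(\<phi> has_derivative (\<lambda>_. 0)) (at z)"
        by (rule has_derivative_transform_within_open[where f = "\<lambda>_. 0" and s = "- cball 0 R"])
           (use that R in auto)
      then have "frechet_derivative \<phi> (at z) = (\<lambda>_. 0)"
        using has_derivative_unique test_function_deriv(1)[OF \<phi>] by blast
      then show ?thesis by (simp add: \<phi>'_def)
    qed
    have parts: "integral\<^sup>L lborel (\<lambda>z. \<phi>' z *\<^sub>R F n z)
        = - integral\<^sup>L lborel (\<lambda>z. \<phi> z *\<^sub>R wirtinger (P n z) (Q n z) v)" for n
      unfolding \<phi>'_def
      by (rule test_function_integration_by_parts[OF \<phi> deriv])
         (auto simp: wirtinger_def intro!: continuous_intros cont)
    obtain M where M: "\<And>n. e n \<le> M"
      using convergent_imp_Bseq[OF convergentI[OF e]] by (auto simp: Bseq_def dest: abs_le_D1)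
    have lhs: "(\<lambda>n. integral\<^sup>L lborel (\<lambda>z. \<phi>' z *\<^sub>R F n z)) \<longlonglongrightarrow> integral\<^sup>L lborel (\<lambda>z. \<phi>' z *\<^sub>R f z)"
    proof (rule integral_dominated_convergence[where w = "\<lambda>z. indicator (cball 0 R) z *\<^sub>R (\<bar>\<phi>' z\<bar> * (norm (f z) + M))"])
      show "integrable lborel (\<lambda>z. indicator (cball 0 R) z *\<^sub>R (\<bar>\<phi>' z\<bar> * (norm (f z) + M)))"
        by (intro borel_integrable_compact continuous_intros continuous_on_subset[OF fc]
            continuous_on_subset[OF cont\<phi>(2)]) auto
      show "AE z in lborel. (\<lambda>n. \<phi>' z *\<^sub>R F n z) \<longlonglongrightarrow> \<phi>' z *\<^sub>R f z"
        by (intro AE_I2 tendsto_intros Flim)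
      have "norm (\<phi>' z *\<^sub>R F n z) \<le> indicator (cball 0 R) z *\<^sub>R (\<bar>\<phi>' z\<bar> * (norm (f z) + M))" for n z
      proof (cases "z \<in> cball 0 R")
        case True
        have "norm (F n z) \<le> norm (f z) + M"
          using norm_triangle_sub[of "F n z" "f z"] unif[of n z] M[of n] by linarith
        then show ?thesis using True by (simp add: mult_left_mono)
      qed (simp add: \<phi>'0)
      then show "AE z in lborel. norm (\<phi>' z *\<^sub>R F n z)
          \<le> indicator (cball 0 R) z *\<^sub>R (\<bar>\<phi>' z\<bar> * (norm (f z) + M))" for n by simp
    qed measurable
    have "bounded (\<phi> ` cball 0 R)"
      by (intro compact_imp_bounded compact_continuous_image continuous_on_subset[OF cont\<phi>(1)]) auto
    then obtain B where B: "\<And>z. z \<in> cball 0 R \<Longrightarrow> \<bar>\<phi> z\<bar> \<le> B"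
      unfolding bounded_iff by (metis imageI real_norm_def)
    have meas_w: "(\<lambda>z. \<phi> z *\<^sub>R wirtinger (s z) (t z) v) \<in> borel_measurable lborel"
      if [measurable]: "s \<in> borel_measurable borel" "t \<in> borel_measurable borel" for s t
    proof -
      have [measurable]: "(\<lambda>z. cnj (t z)) \<in> borel_measurable borel"
        by (rule borel_measurable_continuous_on[of cnj]) (auto intro: continuous_intros)
      show ?thesis unfolding wirtinger_def by measurable
    qed
    have rhs: "(\<lambda>n. integral\<^sup>L lborel (\<lambda>z. \<phi> z *\<^sub>R wirtinger (P n z) (Q n z) v))
        \<longlonglongrightarrow> integral\<^sup>L lborel (\<lambda>z. \<phi> z *\<^sub>R wirtinger (p z) (q z) v)"
    proof (rule integral_dominated_convergence[where w = "\<lambda>z. B * norm v * (indicator (cball 0 R) z *\<^sub>R (H z + 2))"])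
      show "integrable lborel (\<lambda>z. B * norm v * (indicator (cball 0 R) z *\<^sub>R (H z + 2)))"
      proof -
        have "set_integrable lborel (cball 0 R) (\<lambda>z. H z + 2)"
          using H[of R] borel_integrable_compact[of "cball 0 R" "\<lambda>_::complex. 2::real"]
          by (intro set_integral_add) (auto simp: set_integrable_def)
        then show ?thesis unfolding set_integrable_def by (rule integrable_mult_right)
      qed
      show "AE z in lborel. (\<lambda>n. \<phi> z *\<^sub>R wirtinger (P n z) (Q n z) v) \<longlonglongrightarrow> \<phi> z *\<^sub>R wirtinger (p z) (q z) v"
        using plim qlim by eventually_elim (auto simp: wirtinger_def intro!: tendsto_intros)
      show "AE z in lborel. norm (\<phi> z *\<^sub>R wirtinger (P n z) (Q n z) v)
          \<le> B * norm v * (indicator (cball 0 R) z *\<^sub>R (H z + 2))" for n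
        using dom
      proof eventually_elim
        case (elim z)
        show ?case
        proof (cases "z \<in> cball 0 R")
          case True
          have "norm (wirtinger (P n z) (Q n z) v) \<le> (norm (P n z) + norm (Q n z)) * norm v"
            unfolding wirtinger_def using norm_triangle_ineq[of "P n z * v" "Q n z * cnj v"]
            by (simp add: norm_mult algebra_simps)
          also have "\<dots> \<le> (H z + 2) * norm v"
          proof (rule mult_right_mono)
            have "2 * norm (P n z) \<le> (norm (P n z))\<^sup>2 + 1"
              using zero_le_power2[of "norm (P n z) - 1"] by (simp add: power2_diff)
            moreover have "(norm (P n z))\<^sup>2 \<le> H z" using elim by blast
            ultimately show "norm (P n z) + norm (Q n z) \<le> H z + 2"
              using norm_ge_zero[of "P n z"] Q[of n z] by linarith
          qed simp
          finally have "\<bar>\<phi> z\<bar> * norm (wirtinger (P n z) (Q n z) v) \<le> B * ((H z + 2) * norm v)"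
            using B[OF True] by (intro mult_mono) auto
          then show ?thesis using True by (simp add: mult_ac)
        qed (simp add: R)
      qed
    qed (intro meas_w; measurable)+
    have "integral\<^sup>L lborel (\<lambda>z. \<phi>' z *\<^sub>R f z) = - integral\<^sup>L lborel (\<lambda>z. \<phi> z *\<^sub>R wirtinger (p z) (q z) v)"
      using LIMSEQ_unique[OF lhs] tendsto_minus[OF rhs] unfolding parts by blast
    moreover have "integral\<^sup>L lebesgue (\<lambda>z. \<phi>' z *\<^sub>R f z) = integral\<^sup>L lborel (\<lambda>z. \<phi>' z *\<^sub>R f z)"
      by (rule integral_completion) measurable
    moreover have "integral\<^sup>L lebesgue (\<lambda>z. \<phi> z *\<^sub>R wirtinger (p z) (q z) v)
        = integral\<^sup>L lborel (\<lambda>z. \<phi> z *\<^sub>R wirtinger (p z) (q z) v)"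
      by (rule integral_completion) (use meas_w[of p q] in simp)
    ultimately show "(LINT z|lebesgue. frechet_derivative \<phi> (at z) v *\<^sub>R f z)
        = - (LINT z|lebesgue. \<phi> z *\<^sub>R wirtinger (p z) (q z) v)"
      by (simp add: \<phi>'_def)
  qed
  have w1: "wirtinger s t 1 = s + t" and wi: "wirtinger s t \<i> = \<i> * (s - t)" for s t
    by (simp_all add: wirtinger_def algebra_simps)
  have "W12_loc f (\<lambda>z. p z + q z) (\<lambda>z. \<i> * (p z - q z))"
    unfolding W12_loc_def
  proof (intro conjI fL2)
    show "L2_loc (\<lambda>z. p z + q z)"
    proof (rule L2)
      show "AE z in lborel. (norm (p z + q z))\<^sup>2 \<le> 2 * H z + 1"
        using pH q1 by eventually_elim (rule square)
    qed measurable
    show "L2_loc (\<lambda>z. \<i> * (p z - q z))"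
    proof (rule L2)
      show "AE z in lborel. (norm (\<i> * (p z - q z)))\<^sup>2 \<le> 2 * H z + 1"
        using pH q1
      proof eventually_elim
        case (elim z)
        then show ?case using square[of "p z" "H z" "- q z"] by (simp add: norm_mult)
      qed
    qed measurable
  qed (use weak[of 1] weak[of \<i>] in \<open>simp_all add: w1 wi\<close>)
  moreover have "AE z in lborel. (onorm ((*v) (differential_matrix (p z + q z) (\<i> * (p z - q z)))))\<^sup>2
      \<le> 2 * det (differential_matrix (p z + q z) (\<i> * (p z - q z)))"
    using p1 q1 by eventually_elim (rule distortion_le_of_wirtinger)
  ultimately have "W12_loc f (\<lambda>z. p z + q z) (\<lambda>z. \<i> * (p z - q z)) \<and> (\<exists>K::real. 1 \<le> K \<and>
      (AE z in lebesgue. (onorm ((*v) (differential_matrix (p z + q z) (\<i> * (p z - q z)))))\<^sup>2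
        \<le> K * det (differential_matrix (p z + q z) (\<i> * (p z - q z)))))"
    by (intro conjI exI[of _ "2::real"] AE_completion) simp_all
  then show ?thesis
    unfolding quasiconformal_def using homeo by blast
qed

section \<open>A wave concentrated near a line\<close>

lemma DERIV_positive_part_power:
  "((\<lambda>t::real. max 0 t ^ Suc (Suc n)) has_real_derivative real (Suc (Suc n)) * max 0 t ^ Suc n) (at t)"
proof -
  consider "t > 0" | "t < 0" | "t = 0" by linarith
  then show ?thesis
  proof cases
    case 1
    have "((\<lambda>t. t ^ Suc (Suc n)) has_real_derivative real (Suc (Suc n)) * t ^ Suc n) (at t)"
      by (rule derivative_eq_intros refl | simp)+
    then have "((\<lambda>t. max 0 t ^ Suc (Suc n)) has_real_derivative real (Suc (Suc n)) * t ^ Suc n) (at t)"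
      by (rule has_field_derivative_transform_within_open[where S = "{0<..}"]) (use 1 in auto)
    then show ?thesis using 1 by simp
  next
    case 2
    have "((\<lambda>t. max 0 t ^ Suc (Suc n)) has_real_derivative 0) (at t)"
      by (rule has_field_derivative_transform_within_open[where f = "\<lambda>_. 0" and S = "{..<0}"]) (use 2 in auto)
    then show ?thesis using 2 by simp
  next
    case 3
    have "max 0 h ^ Suc (Suc n) / h = max 0 h ^ Suc n" for h :: real
      by (cases "h > 0") (auto simp: max_def)
    moreover have "((\<lambda>h::real. max 0 h ^ Suc n) \<longlongrightarrow> max 0 0 ^ Suc n) (at 0)"
      by (intro tendsto_intros)
    ultimately show ?thesis using 3 by (simp add: DERIV_def)
  qed
qed

text \<open>The profile \<open>bump\<close> and its derivatives. The constant \<open>6\<close> is chosen such that \<open>bump'' 0 = - bump 0\<close>, and the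
  third power makes \<open>bump\<close> twice continuously differentiable.\<close>

definition cap :: "real \<Rightarrow> real" where "cap s = max 0 (1 - s\<^sup>2 / 6)"
definition bump :: "real \<Rightarrow> real" where "bump s = cap s ^ 3"
definition bump' :: "real \<Rightarrow> real" where "bump' s = - s * (cap s)\<^sup>2"
definition bump'' :: "real \<Rightarrow> real" where "bump'' s = 2/3 * s\<^sup>2 * cap s - (cap s)\<^sup>2"

lemma cap_bounds: "0 \<le> cap s" "cap s \<le> 1" by (auto simp: cap_def)

lemma cap_eq_0: "cap s = 0" if "3 \<le> \<bar>s\<bar>"
proof -
  have "3\<^sup>2 \<le> \<bar>s\<bar>\<^sup>2" using that by (intro power_mono) auto
  then show ?thesis by (simp add: cap_def)
qed

lemma DERIV_bump: "(bump has_real_derivative bump' s) (at s)"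
proof -
  have "((\<lambda>s. 1 - s\<^sup>2 / 6) has_real_derivative - s / 3) (at s)"
    by (auto intro!: derivative_eq_intros)
  from DERIV_chain2[OF DERIV_positive_part_power[of 1] this]
  show ?thesis by (simp add: bump_def[abs_def] bump'_def cap_def numeral_eq_Suc mult_ac)
qed

lemma DERIV_bump': "(bump' has_real_derivative bump'' s) (at s)"
proof -
  have "((\<lambda>s. 1 - s\<^sup>2 / 6) has_real_derivative - s / 3) (at s)"
    by (auto intro!: derivative_eq_intros)
  from DERIV_chain2[OF DERIV_positive_part_power[of 0] this]
  have "((\<lambda>s. (cap s)\<^sup>2) has_real_derivative 2 * cap s * (- s / 3)) (at s)"
    by (simp add: cap_def numeral_eq_Suc)
  from DERIV_mult[OF DERIV_minus[OF DERIV_ident] this]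
  show ?thesis by (simp add: bump'_def[abs_def] bump''_def power2_eq_square algebra_simps)
qed

lemma cap_continuous: "continuous_on S cap"
  unfolding cap_def by (intro continuous_intros) auto

lemma bump_continuous: "continuous_on S bump" "continuous_on S bump'" "continuous_on S bump''"
  unfolding bump_def bump'_def bump''_def by (intro continuous_intros cap_continuous)+

lemma bump_bounds: "0 \<le> bump s" "bump s \<le> 1" "\<bar>bump' s\<bar> \<le> \<bar>s\<bar>"
proof -
  show "0 \<le> bump s" "bump s \<le> 1"
    using cap_bounds[of s] by (auto simp: bump_def power_le_one)
  have "\<bar>s\<bar> * (cap s)\<^sup>2 \<le> \<bar>s\<bar> * 1"
    using cap_bounds[of s] by (intro mult_left_mono power_le_one) auto
  then show "\<bar>bump' s\<bar> \<le> \<bar>s\<bar>" by (simp add: bump'_def abs_mult)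
qed

lemma bump_outside: "bump s = 0" "bump' s = 0" "bump'' s = 0" if "3 \<le> \<bar>s\<bar>"
  using cap_eq_0[OF that] by (simp_all add: bump_def bump'_def bump''_def)

lemma abs_bump'_le_3: "\<bar>bump' s\<bar> \<le> 3"
  using bump_bounds(3)[of s] bump_outside(2)[of s] by (cases "3 \<le> \<bar>s\<bar>") auto

text \<open>The factor \<open>s\<^sup>2\<close> in \<open>bump s + bump'' s = cap s * (2/3 - cap s / 6) * s\<^sup>2\<close> reflects that
  \<open>sin x * bump y\<close> solves the wave equation on the axis.\<close>

lemma abs_bump_plus_bump''_le: "\<bar>bump s + bump'' s\<bar> \<le> 2 * \<bar>s\<bar>"
proof (cases "3 \<le> \<bar>s\<bar>")
  case True
  then show ?thesis using bump_outside[OF True] by simp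
next
  case False
  show ?thesis
  proof (cases "cap s = 0")
    case True
    then show ?thesis by (simp add: bump_def bump''_def)
  next
    case cap: False
    then have c: "cap s = 1 - s\<^sup>2 / 6" by (simp add: cap_def max_def split: if_splits)
    have "bump s + bump'' s = cap s * (cap s * (cap s - 1) + 2/3 * s\<^sup>2)"
      by (simp add: bump_def bump''_def power2_eq_square power3_eq_cube algebra_simps)
    also have "cap s - 1 = - s\<^sup>2 / 6" by (simp add: c)
    also have "cap s * (cap s * (- s\<^sup>2 / 6) + 2/3 * s\<^sup>2) = cap s * (2/3 - cap s / 6) * s\<^sup>2"
      by (simp add: algebra_simps)
    finally have eq: "bump s + bump'' s = cap s * (2/3 - cap s / 6) * s\<^sup>2" .
    have "\<bar>bump s + bump'' s\<bar> = cap s * (2/3 - cap s / 6) * s\<^sup>2"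
      unfolding eq using cap_bounds[of s] by (intro abs_of_nonneg mult_nonneg_nonneg) auto
    also have "\<dots> \<le> 1 * (2/3) * s\<^sup>2"
      using cap_bounds[of s] by (intro mult_mono) auto
    also have "\<dots> = 2/3 * \<bar>s\<bar> * \<bar>s\<bar>" by (simp add: power2_eq_square)
    also have "\<dots> \<le> 2/3 * 3 * \<bar>s\<bar>"
      using False by (intro mult_right_mono mult_left_mono) auto
    finally show ?thesis by simp
  qed
qed

lemma abs_bump''_minus_bump_le: "\<bar>bump'' s - bump s\<bar> \<le> 8"
proof (cases "3 \<le> \<bar>s\<bar>")
  case True
  then show ?thesis using bump_outside[OF True] by simp
next
  case False
  have "\<bar>bump'' s - bump s\<bar> \<le> \<bar>bump s + bump'' s\<bar> + 2 * bump s"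
    using bump_bounds(1)[of s] by linarith
  also have "\<dots> \<le> 2 * 3 + 2 * 1"
    using abs_bump_plus_bump''_le[of s] bump_bounds[of s] False by linarith
  finally show ?thesis by simp
qed

text \<open>In the coordinates \<open>x + i * y = cnj u * z\<close> this is \<open>i\<close> times the gradient of the potential
  \<open>a * r\<^sup>2 * sin (x / r) * bump ((y - h) / r)\<close>, written as a complex number.\<close>

definition wave :: "complex \<Rightarrow> real \<Rightarrow> real \<Rightarrow> real \<Rightarrow> complex \<Rightarrow> complex" where
  "wave u a r h z = (let X = Re (cnj u * z) / r; s = (Im (cnj u * z) - h) / r in
     \<i> * u * (of_real (a * r) * Complex (cos X * bump s) (sin X * bump' s)))"

text \<open>Half the Laplacian of the potential. The derivative of \<open>wave\<close> with respect to \<open>z\<close> is \<open>i\<close> times this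
  real number.\<close>

definition wave_z :: "complex \<Rightarrow> real \<Rightarrow> real \<Rightarrow> real \<Rightarrow> complex \<Rightarrow> real" where
  "wave_z u a r h z = (let X = Re (cnj u * z) / r; s = (Im (cnj u * z) - h) / r in
     a / 2 * sin X * (bump'' s - bump s))"

definition wave_zbar :: "complex \<Rightarrow> real \<Rightarrow> real \<Rightarrow> real \<Rightarrow> complex \<Rightarrow> complex" where
  "wave_zbar u a r h z = (let X = Re (cnj u * z) / r; s = (Im (cnj u * z) - h) / r in
     \<i> * u\<^sup>2 * Complex (- (a / 2) * sin X * (bump s + bump'' s)) (a * cos X * bump' s))"

lemma has_derivative_wave:
  assumes u: "norm u = 1" and "r > 0"
  shows "(wave u a r h has_derivative
    wirtinger (\<i> * of_real (wave_z u a r h z)) (wave_zbar u a r h z)) (at z)"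
proof -
  define X where "X z = Re (cnj u * z) / r" for z
  define s where "s z = (Im (cnj u * z) - h) / r" for z
  have X: "(X has_derivative (\<lambda>w. Re (cnj u * w) / r)) (at z)"
    unfolding X_def using \<open>r > 0\<close> by (auto intro!: derivative_eq_intros)
  have s: "(s has_derivative (\<lambda>w. Im (cnj u * w) / r)) (at z)"
    unfolding s_def using \<open>r > 0\<close> by (auto intro!: derivative_eq_intros)
  have cosX: "((\<lambda>z. cos (X z)) has_derivative (\<lambda>w. - sin (X z) * (Re (cnj u * w) / r))) (at z)"
    using has_derivative_compose[OF X DERIV_cos[of "X z", unfolded has_field_derivative_def]] by simp
  have sinX: "((\<lambda>z. sin (X z)) has_derivative (\<lambda>w. cos (X z) * (Re (cnj u * w) / r))) (at z)"
    using has_derivative_compose[OF X DERIV_sin[of "X z", unfolded has_field_derivative_def]] by simp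
  have b: "((\<lambda>z. bump (s z)) has_derivative (\<lambda>w. bump' (s z) * (Im (cnj u * w) / r))) (at z)"
    using has_derivative_compose[OF s DERIV_bump[of "s z", unfolded has_field_derivative_def]] by simp
  have b': "((\<lambda>z. bump' (s z)) has_derivative (\<lambda>w. bump'' (s z) * (Im (cnj u * w) / r))) (at z)"
    using has_derivative_compose[OF s DERIV_bump'[of "s z", unfolded has_field_derivative_def]] by simp
  have Cx: "Complex p q = of_real p + \<i> * of_real q" for p q
    by (simp add: complex_eq_iff)
  have d: "((\<lambda>z. \<i> * u * (of_real (a * r) * Complex (cos (X z) * bump (s z)) (sin (X z) * bump' (s z)))) has_derivative
     (\<lambda>w. \<i> * u * (of_real (a * r) * Complex
        (cos (X z) * (bump' (s z) * (Im (cnj u * w) / r)) + - sin (X z) * (Re (cnj u * w) / r) * bump (s z))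
        (sin (X z) * (bump'' (s z) * (Im (cnj u * w) / r)) + cos (X z) * (Re (cnj u * w) / r) * bump' (s z))))) (at z)"
    unfolding Cx
    by (intro has_derivative_mult_right has_derivative_add has_derivative_of_real has_derivative_mult
        cosX sinX b b')
  have "\<i> * u * (of_real (a * r) * Complex
        (cos (X z) * (bump' (s z) * (Im (cnj u * w) / r)) + - sin (X z) * (Re (cnj u * w) / r) * bump (s z))
        (sin (X z) * (bump'' (s z) * (Im (cnj u * w) / r)) + cos (X z) * (Re (cnj u * w) / r) * bump' (s z)))
      = wirtinger (\<i> * of_real (wave_z u a r h z)) (wave_zbar u a r h z) w" for w
  proof -
    define \<omega> where "\<omega> = cnj u * w"
    have uu: "u * cnj u = 1" using u complex_norm_square[of u] by simp
    have w: "w = u * \<omega>" using uu by (simp add: \<omega>_def mult.assoc[symmetric])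
    have uw: "u\<^sup>2 * cnj w = u * cnj \<omega>"
    proof -
      have "u\<^sup>2 * cnj w = (u * cnj u) * (u * cnj \<omega>)" by (simp add: w power2_eq_square mult_ac)
      then show ?thesis by (simp add: uu)
    qed
    let ?q = "Complex (- (a / 2) * sin (X z) * (bump (s z) + bump'' (s z))) (a * cos (X z) * bump' (s z))"
    let ?p = "a / 2 * sin (X z) * (bump'' (s z) - bump (s z))"
    have "wirtinger (\<i> * of_real (wave_z u a r h z)) (wave_zbar u a r h z) w
       = \<i> * of_real ?p * w + \<i> * ?q * (u\<^sup>2 * cnj w)"
      by (simp add: wirtinger_def wave_z_def wave_zbar_def Let_def X_def s_def mult_ac)
    also have "\<dots> = \<i> * u * (of_real ?p * \<omega> + ?q * cnj \<omega>)"
      unfolding uw by (simp add: w algebra_simps)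
    also have "of_real ?p * \<omega> + ?q * cnj \<omega> = of_real (a * r) * Complex
        (cos (X z) * (bump' (s z) * (Im \<omega> / r)) + - sin (X z) * (Re \<omega> / r) * bump (s z))
        (sin (X z) * (bump'' (s z) * (Im \<omega> / r)) + cos (X z) * (Re \<omega> / r) * bump' (s z))"
      using \<open>r > 0\<close> by (simp add: complex_eq_iff field_simps)
    finally show ?thesis by (simp add: \<omega>_def)
  qed
  moreover have "wave u a r h
      = (\<lambda>z. \<i> * u * (of_real (a * r) * Complex (cos (X z) * bump (s z)) (sin (X z) * bump' (s z))))"
    by (simp only: wave_def[abs_def] Let_def X_def s_def)
  ultimately show ?thesis using d by (simp only:)
qed

lemma wave_z_bound: "\<bar>wave_z u a r h z\<bar> \<le> 4 * \<bar>a\<bar>"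
proof -
  have "\<bar>a / 2\<bar> * \<bar>sin X\<bar> * \<bar>bump'' s - bump s\<bar> \<le> \<bar>a / 2\<bar> * 1 * 8" for X s
    by (intro mult_mono abs_bump''_minus_bump_le) auto
  then show ?thesis by (simp add: wave_z_def Let_def abs_mult)
qed

text \<open>The crucial estimate: the conjugate derivative vanishes to first order on the line at height \<open>h\<close>.\<close>

lemma wave_zbar_bound:
  assumes "norm u = 1"
  shows "norm (wave_zbar u a r h z) \<le> 2 * \<bar>a\<bar> * \<bar>(Im (cnj u * z) - h) / r\<bar>"
proof -
  define s where "s = (Im (cnj u * z) - h) / r"
  define X where "X = Re (cnj u * z) / r"
  have "norm (wave_zbar u a r h z) = norm (Complex (- (a / 2) * sin X * (bump s + bump'' s)) (a * cos X * bump' s))"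
    using assms by (simp add: wave_zbar_def Let_def s_def X_def norm_mult norm_power)
  also have "\<dots> \<le> \<bar>- (a / 2) * sin X * (bump s + bump'' s)\<bar> + \<bar>a * cos X * bump' s\<bar>"
    using cmod_le[of "Complex (- (a / 2) * sin X * (bump s + bump'' s)) (a * cos X * bump' s)"] by simp
  also have "\<dots> = \<bar>a\<bar> / 2 * \<bar>sin X\<bar> * \<bar>bump s + bump'' s\<bar> + \<bar>a\<bar> * \<bar>cos X\<bar> * \<bar>bump' s\<bar>"
    by (simp add: abs_mult)
  also have "\<dots> \<le> \<bar>a\<bar> / 2 * 1 * (2 * \<bar>s\<bar>) + \<bar>a\<bar> * 1 * \<bar>s\<bar>"
    by (intro add_mono mult_mono abs_bump_plus_bump''_le bump_bounds) auto
  finally show ?thesis by (simp add: s_def)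
qed

lemma wave_outside:
  assumes "3 \<le> \<bar>(Im (cnj u * z) - h) / r\<bar>"
  shows "wave_z u a r h z = 0" "wave_zbar u a r h z = 0"
  using bump_outside[OF assms] by (simp_all add: wave_z_def wave_zbar_def Let_def complex_eq_iff)

lemma wave_bound:
  assumes "norm u = 1"
  shows "norm (wave u a r h z) \<le> 4 * \<bar>a * r\<bar>"
proof -
  define s where "s = (Im (cnj u * z) - h) / r"
  define X where "X = Re (cnj u * z) / r"
  have "norm (Complex (cos X * bump s) (sin X * bump' s)) \<le> \<bar>cos X\<bar> * \<bar>bump s\<bar> + \<bar>sin X\<bar> * \<bar>bump' s\<bar>"
    using cmod_le[of "Complex (cos X * bump s) (sin X * bump' s)"] by (simp add: abs_mult)
  also have "\<dots> \<le> 1 * 1 + 1 * 3"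
    using bump_bounds[of s] by (intro add_mono mult_mono abs_bump'_le_3) auto
  finally have "\<bar>a * r\<bar> * norm (Complex (cos X * bump s) (sin X * bump' s)) \<le> \<bar>a * r\<bar> * 4"
    by (intro mult_left_mono) auto
  then show ?thesis
    using assms by (simp add: wave_def Let_def s_def X_def norm_mult abs_mult mult_ac)
qed

lemma wave_on_line:
  assumes "norm u = 1"
  shows "Im (cnj u * wave u a r h z) = a * r * cos (Re (cnj u * z) / r) * bump ((Im (cnj u * z) - h) / r)"
proof -
  have "cnj u * u = 1" using assms complex_norm_square[of u] by (simp add: mult.commute)
  then have "cnj u * wave u a r h z = \<i> * (of_real (a * r) * Complex (cos (Re (cnj u * z) / r) * bump ((Im (cnj u * z) - h) / r))
      (sin (Re (cnj u * z) / r) * bump' ((Im (cnj u * z) - h) / r)))"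
    by (simp add: wave_def Let_def mult.assoc[symmetric] mult.left_commute[of "cnj u" "\<i>"])
  then show ?thesis by simp
qed

lemma wave_continuous:
  assumes "r > 0"
  shows "continuous_on S (wave_z u a r h)" "continuous_on S (wave_zbar u a r h)"
proof -
  have Cx: "Complex p q = of_real p + \<i> * of_real q" for p q
    by (simp add: complex_eq_iff)
  show "continuous_on S (wave_z u a r h)" "continuous_on S (wave_zbar u a r h)"
    unfolding wave_z_def wave_zbar_def Let_def Cx using assms
    by (auto intro!: continuous_intros bump_continuous[THEN continuous_on_compose2])
qed

section \<open>Measure of strips and summation over scales\<close>

text \<open>About \<open>1 / (2 * \<rho>)\<close> translates of the strip in its normal direction are disjoint and fit into a ball of
  slightly larger radius, which bounds the measure of each of them.\<close>

lemma measure_strip_le: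
  assumes u: "norm u = 1" and "\<rho> > 0"
  shows "measure lborel {z \<in> cball 0 R. \<bar>Im (cnj u * z) - h\<bar> < \<rho>} \<le> 2 * \<rho> * measure lborel (cball (0::complex) (R + 1))"
proof -
  define S where "S = {z \<in> cball 0 R. \<bar>Im (cnj u * z) - h\<bar> < \<rho>}"
  define N where "N = nat \<lceil>1 / (2 * \<rho>)\<rceil>"
  have N: "1 / (2 * \<rho>) \<le> N" "N < 1 / (2 * \<rho>) + 1"
    using \<open>\<rho> > 0\<close> ceiling_correct[of "1 / (2 * \<rho>)"] unfolding N_def
    by (simp_all add: of_nat_nat)
  define v where "v n = of_real (2 * \<rho> * real n) * (\<i> * u)" for n :: nat
  have S_borel: "S \<in> sets borel"
  proof -
    have "S = cball 0 R \<inter> {z. \<bar>Im (cnj u * z) - h\<bar> < \<rho>}" by (auto simp: S_def)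
    moreover have "open {z. \<bar>Im (cnj u * z) - h\<bar> < \<rho>}"
      by (intro open_Collect_less continuous_intros)
    ultimately show ?thesis by auto
  qed
  have trans: "(+) (v n) ` S = {z. z - v n \<in> S}" for n
  proof (intro set_eqI iffI)
    fix z assume "z \<in> {z. z - v n \<in> S}"
    then show "z \<in> (+) (v n) ` S" by (intro image_eqI[of _ _ "z - v n"]) auto
  qed auto
  have T_borel: "(+) (v n) ` S \<in> sets borel" for n
  proof -
    have "(\<lambda>z. z - v n) \<in> borel \<rightarrow>\<^sub>M borel" by measurable
    from measurable_sets[OF this S_borel] show ?thesis
      unfolding trans by (simp add: vimage_def)
  qed
  have uu: "cnj u * u = 1" using u complex_norm_square[of u] by (simp add: mult.commute)
  have Im: "Im (cnj u * (z - v n)) = Im (cnj u * z) - 2 * \<rho> * n" for z n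
  proof -
    have "cnj u * v n = \<i> * of_real (2 * \<rho> * n) * (cnj u * u)"
      by (simp add: v_def mult_ac)
    then show ?thesis unfolding uu right_diff_distrib by simp
  qed
  have disj: "disjoint_family_on (\<lambda>n. (+) (v n) ` S) {..<N}"
  proof (unfold disjoint_family_on_def, intro ballI impI)
    fix m n :: nat assume "m \<noteq> n"
    show "(+) (v m) ` S \<inter> (+) (v n) ` S = {}"
    proof (rule ccontr)
      assume "\<not> ?thesis"
      then obtain z where "z - v m \<in> S" "z - v n \<in> S" unfolding trans by blast
      then have "\<bar>Im (cnj u * z) - 2 * \<rho> * m - h\<bar> < \<rho>" "\<bar>Im (cnj u * z) - 2 * \<rho> * n - h\<bar> < \<rho>"
        unfolding S_def by (simp_all only: mem_Collect_eq Im)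
      then have "\<bar>2 * \<rho> * m - 2 * \<rho> * n\<bar> < 2 * \<rho>" by linarith
      then have "2 * \<rho> * \<bar>real m - real n\<bar> < 2 * \<rho> * 1"
        using \<open>\<rho> > 0\<close> by (simp add: abs_mult right_diff_distrib[symmetric])
      then have "\<bar>real m - real n\<bar> < 1" using \<open>\<rho> > 0\<close> by (simp only: mult_less_cancel_left_pos mult_pos_pos zero_less_numeral)
      then show False using \<open>m \<noteq> n\<close> by linarith
    qed
  qed
  have sub: "(+) (v n) ` S \<subseteq> cball 0 (R + 1)" if "n < N" for n
  proof
    fix z assume "z \<in> (+) (v n) ` S"
    then have "norm (z - v n) \<le> R" by (auto simp: trans S_def)
    moreover have "norm (v n) \<le> 1"
    proof -
      have "real n \<le> 1 / (2 * \<rho>)" using that N by linarith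
      then show ?thesis using u \<open>\<rho> > 0\<close> by (simp add: v_def norm_mult field_simps)
    qed
    ultimately show "z \<in> cball 0 (R + 1)"
      using norm_triangle_sub[of z "v n"] by (simp add: mem_cball_0)
  qed
  have fin: "emeasure lborel A < \<infinity>" if "A \<subseteq> cball 0 (R + 1)" for A :: "complex set"
    using that bounded_subset[OF bounded_cball] by (intro emeasure_bounded_finite) auto
  have "measure lborel ((+) (v n) ` S) = measure lborel S" for n
    using measure_translation[of "v n" S] S_borel T_borel[of n] by simp
  then have "real N * measure lborel S = (\<Sum>n<N. measure lborel ((+) (v n) ` S))" by simp
  also have "\<dots> = measure lborel (\<Union>n<N. (+) (v n) ` S)"
  proof (intro measure_finite_Union[symmetric] disj)
    show "emeasure lborel ((+) (v n) ` S) \<noteq> \<infinity>" if "n \<in> {..<N}" for n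
      using fin[OF sub, of n] that by (simp add: less_top)
  qed (use T_borel in auto)
  also have "\<dots> \<le> measure lborel (cball 0 (R + 1) :: complex set)"
    using sub T_borel fin[of "cball 0 (R + 1)"] by (intro measure_mono_fmeasurable fmeasurableI) auto
  finally have "1 / (2 * \<rho>) * measure lborel S \<le> measure lborel (cball 0 (R + 1) :: complex set)"
    using mult_right_mono[OF N(1), of "measure lborel S"] by simp
  then show ?thesis using \<open>\<rho> > 0\<close> by (simp add: S_def field_simps)
qed

text \<open>A geometric series: its largest term is less than \<open>3\<close>, and the terms at least double with \<open>k\<close> as long as
  they do not vanish.\<close>

lemma sum_truncated_ratio_le:
  fixes r :: "nat \<Rightarrow> real"
  assumes r_pos: "\<And>k. 0 < r k" and half: "\<And>k. r (Suc k) \<le> r k / 2" and "0 \<le> d"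
  shows "(\<Sum>k<n. if d < 3 * r k then d / r k else 0) \<le> 6"
proof -
  let ?T = "\<lambda>n. \<Sum>k<n. if d < 3 * r k then d / r k else 0"
  have lt6: "d / r n \<le> 3" if "d < 3 * r n" for n
    using that r_pos[of n] by (simp add: field_simps)
  have "?T (Suc n) \<le> 6 \<and> (d < 3 * r n \<longrightarrow> ?T (Suc n) \<le> 2 * (d / r n))" for n
  proof (induction n)
    case 0
    then show ?case using lt6[of 0] divide_nonneg_pos[OF \<open>0 \<le> d\<close> r_pos[of 0]] by auto
  next
    case (Suc n)
    show ?case
    proof (cases "d < 3 * r (Suc n)")
      case True
      then have "d < 3 * r n" using half[of n] r_pos[of n] by linarith
      then have "?T (Suc n) \<le> 2 * (d / r n)" using Suc by blast
      also have "\<dots> \<le> d / r (Suc n)"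
      proof -
        have "d * (2 * r (Suc n)) \<le> d * r n"
          using half[of n] \<open>0 \<le> d\<close> by (intro mult_left_mono) auto
        then show ?thesis using r_pos[of n] r_pos[of "Suc n"] by (simp add: field_simps)
      qed
      finally have "?T (Suc n) + d / r (Suc n) \<le> 2 * (d / r (Suc n))" by linarith
      moreover have "?T (Suc (Suc n)) = ?T (Suc n) + d / r (Suc n)"
        using True unfolding sum.lessThan_Suc[of _ "Suc n"] by (simp only: if_True)
      ultimately show ?thesis using lt6[OF True] by (intro conjI impI) linarith+
    next
      case False
      then show ?thesis using Suc by simp
    qed
  qed
  then have "?T (Suc n) \<le> 6" for n by blast
  then show ?thesis by (cases n) auto
qed

definition scale :: "nat \<Rightarrow> real" where "scale k = (1/2) ^ (k * k)"

text \<open>Every line index occurs for infinitely many \<open>k\<close>.\<close>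

definition line_index :: "nat \<Rightarrow> nat" where "line_index k = fst (prod_decode k)"

text \<open>The amplitudes depend only on the line, so that infinitely many of them agree on each line; the factor
  \<open>1/100\<close> keeps the conjugate derivative of the final map below \<open>1/3\<close>.\<close>

definition amplitude :: "nat \<Rightarrow> real" where "amplitude k = (1/2) ^ line_index k / 100"

lemma scale_pos: "0 < scale k" by (simp add: scale_def)

lemma scale_Suc: "scale (Suc k) \<le> scale k * (1/2) ^ Suc k"
proof -
  have "Suc k * Suc k = (k * k + Suc k) + k" by simp
  then have "scale (Suc k) = scale k * (1/2) ^ Suc k * (1/2) ^ k"
    unfolding scale_def by (simp only: power_add)
  also have "\<dots> \<le> scale k * (1/2) ^ Suc k * 1"
    using scale_pos[of k] by (intro mult_left_mono power_le_one) auto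
  finally show ?thesis by simp
qed

lemma scale_Suc_half: "scale (Suc k) \<le> scale k / 2"
proof -
  have "scale k * (1/2) ^ Suc k \<le> scale k * (1/2)"
    using scale_pos[of k] power_le_one[of "1/2::real" k] by (intro mult_left_mono) auto
  then show ?thesis using scale_Suc[of k] by simp
qed

lemma scale_le: "scale k \<le> (1/2) ^ k"
  unfolding scale_def by (intro power_decreasing) auto

lemma summable_scale_2: "summable (\<lambda>k. 2 ^ k * scale k)"
proof (rule summable_comparison_test'[of "\<lambda>k. 2 * (1/2) ^ k" 0])
  show "norm (2 ^ k * scale k) \<le> 2 * (1/2::real) ^ k" for k
  proof -
    have "2 * k \<le> k * k + 1"
      by (cases k) simp_all
    then have "(1/2::real) ^ (k * k + 1) \<le> (1/2) ^ (k + k)"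
      by (intro power_decreasing) auto
    then have "scale k \<le> 2 * ((1/2) ^ k * (1/2) ^ k)"
      by (simp add: scale_def power_add)
    then have "2 ^ k * scale k \<le> 2 ^ k * (2 * ((1/2) ^ k * (1/2) ^ k))"
      by (intro mult_left_mono) auto
    also have "\<dots> = 2 * (1/2) ^ k" by (simp add: power_one_over)
    finally show ?thesis using scale_pos[of k] by simp
  qed
qed (intro summable_mult summable_geometric; simp)

lemma line_index_le: "line_index k \<le> k"
  using le_prod_encode_1[of "fst (prod_decode k)" "snd (prod_decode k)"] by (simp add: line_index_def)

lemma amplitude_bounds: "0 < amplitude k" "amplitude k \<le> 1 / 100"
  by (auto simp: amplitude_def power_le_one)

text \<open>Regrouping by lines: the bound \<open>B\<close> for each line is weighted by its amplitude, and the amplitudes of all lines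
  add up to at most \<open>1/50\<close>.\<close>

lemma sum_amplitude_le:
  assumes nonneg: "\<And>j k. 0 \<le> f j k" and le: "\<And>j. (\<Sum>k<n. f j k) \<le> B"
  shows "(\<Sum>k<n. amplitude k * f (line_index k) k) \<le> B / 50"
proof -
  have "B \<ge> 0" using le[of 0] sum_nonneg[of "{..<n}" "f 0"] nonneg by fastforce
  have "(\<Sum>k<n. amplitude k * f (line_index k) k)
     = (\<Sum>k<n. \<Sum>j<n. if line_index k = j then (1/2) ^ j / 100 * f j k else 0)"
  proof (rule sum.cong)
    fix k assume "k \<in> {..<n}"
    then have "line_index k < n" using line_index_le[of k] by simp
    then show "amplitude k * f (line_index k) k
        = (\<Sum>j<n. if line_index k = j then (1/2) ^ j / 100 * f j k else 0)"
      by (subst sum.delta') (auto simp: amplitude_def)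
  qed simp
  also have "\<dots> = (\<Sum>j<n. \<Sum>k<n. if line_index k = j then (1/2) ^ j / 100 * f j k else 0)"
    by (rule sum.swap)
  also have "\<dots> \<le> (\<Sum>j<n. (1/2) ^ j / 100 * (\<Sum>k<n. f j k))"
    unfolding sum_distrib_left using nonneg by (intro sum_mono) auto
  also have "\<dots> \<le> (\<Sum>j<n. (1/2) ^ j / 100 * B)"
    by (intro sum_mono mult_left_mono le) auto
  also have "\<dots> = (\<Sum>j<n. (1/2) ^ j) * (B / 100)"
    by (simp add: sum_distrib_right)
  also have "\<dots> \<le> 2 * (B / 100)"
  proof (rule mult_right_mono)
    have "(\<Sum>j<n. (1/2::real) ^ j) \<le> (\<Sum>j. (1/2) ^ j)"
      by (intro sum_le_suminf summable_geometric) auto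
    then show "(\<Sum>j<n. (1/2::real) ^ j) \<le> 2" by (simp add: suminf_geometric)
  qed (use \<open>B \<ge> 0\<close> in auto)
  finally show ?thesis by simp
qed

section \<open>The quasiconformal map of a family of lines\<close>

text \<open>The family of lines \<open>{z. Im (cnj u * z) = y j}\<close> with common direction \<open>u\<close>.\<close>

locale line_family =
  fixes u :: complex and y :: "nat \<Rightarrow> real"
  assumes norm_u: "norm u = 1"
begin

definition height :: "nat \<Rightarrow> real" where "height k = y (line_index k)"

definition ripple :: "nat \<Rightarrow> complex \<Rightarrow> complex" where
  "ripple k = wave u (amplitude k) (scale k) (height k)"

definition ripple_z :: "nat \<Rightarrow> complex \<Rightarrow> real" where
  "ripple_z k = wave_z u (amplitude k) (scale k) (height k)"

definition ripple_zbar :: "nat \<Rightarrow> complex \<Rightarrow> complex" where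
  "ripple_zbar k = wave_zbar u (amplitude k) (scale k) (height k)"

definition qc_map :: "complex \<Rightarrow> complex" where
  "qc_map z = z + (\<Sum>k. ripple k z)"

definition strip :: "nat \<Rightarrow> complex set" where
  "strip k = {z. \<bar>Im (cnj u * z) - height k\<bar> < 3 * scale k}"

lemma open_strip: "open (strip k)"
  unfolding strip_def by (intro open_Collect_less continuous_intros)

lemma ratio_outside_strip: "3 \<le> \<bar>(Im (cnj u * z) - height k) / scale k\<bar>" if "z \<notin> strip k"
  using that scale_pos[of k] unfolding strip_def
  by (simp only: mem_Collect_eq not_less abs_divide abs_of_pos pos_le_divide_eq)

lemma ripple_outside_strip: "ripple_z k z = 0" "ripple_zbar k z = 0" if "z \<notin> strip k"
  using wave_outside[OF ratio_outside_strip[OF that]] by (simp_all add: ripple_z_def ripple_zbar_def)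

lemma norm_ripple_le: "norm (ripple k z) \<le> (1/2) ^ k"
proof -
  have "norm (ripple k z) \<le> 4 * \<bar>amplitude k * scale k\<bar>"
    unfolding ripple_def by (rule wave_bound[OF norm_u])
  also have "\<dots> = 4 * amplitude k * scale k"
    using amplitude_bounds[of k] scale_pos[of k] by (simp add: abs_mult)
  also have "\<dots> \<le> 1 * (1/2) ^ k"
    using amplitude_bounds[of k] scale_pos[of k] by (intro mult_mono scale_le) auto
  finally show ?thesis by simp
qed

lemma summable_ripple: "summable (\<lambda>k. ripple k z)"
  by (rule summable_comparison_test'[of "\<lambda>k. (1/2) ^ k" 0]) (auto simp: norm_ripple_le)

lemma norm_qc_map_minus_partial_sum_le:
  "norm ((z + (\<Sum>k<n. ripple k z)) - qc_map z) \<le> 2 * (1/2) ^ n"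
proof -
  have g: "(\<lambda>k. (1/2) ^ n * (1/2) ^ k) sums ((1/2) ^ n * (1 / (1 - 1/2 :: real)))"
    by (intro sums_mult geometric_sums) simp
  have "(z + (\<Sum>k<n. ripple k z)) - qc_map z = - (\<Sum>k. ripple (k + n) z)"
    unfolding qc_map_def by (subst suminf_split_initial_segment[OF summable_ripple, of _ n]) simp
  moreover have "norm (\<Sum>k. ripple (k + n) z) \<le> (\<Sum>k. (1/2) ^ n * (1/2) ^ k)"
    by (rule norm_suminf_le) (use norm_ripple_le[of "_ + n" z] sums_summable[OF g] in \<open>auto simp: power_add mult.commute\<close>)
  ultimately show ?thesis using sums_unique[OF g] by simp
qed

text \<open>Each line contributes at most \<open>2 * 6\<close> times its amplitude, by the geometric series of
  \<open>sum_truncated_ratio_le\<close>.\<close>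

lemma norm_sum_ripple_zbar_le: "norm (\<Sum>k<n. ripple_zbar k z) \<le> 1/3"
proof -
  define d where "d j = \<bar>Im (cnj u * z) - y j\<bar>" for j
  define g where "g j k = (if d j < 3 * scale k then d j / scale k else 0)" for j k
  have g: "0 \<le> g j k" for j k using scale_pos[of k] by (simp add: g_def d_def)
  have "norm (ripple_zbar k z) \<le> 2 * (amplitude k * g (line_index k) k)" for k
  proof (cases "z \<in> strip k")
    case True
    have "norm (ripple_zbar k z) \<le> 2 * \<bar>amplitude k\<bar> * \<bar>(Im (cnj u * z) - height k) / scale k\<bar>"
      unfolding ripple_zbar_def by (rule wave_zbar_bound[OF norm_u])
    also have "\<bar>(Im (cnj u * z) - height k) / scale k\<bar> = g (line_index k) k"
      using True scale_pos[of k] unfolding strip_def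
      by (simp only: g_def d_def height_def mem_Collect_eq abs_divide abs_of_pos if_True)
    finally show ?thesis using amplitude_bounds[of k] by simp
  next
    case False
    then show ?thesis using g amplitude_bounds[of k] by (simp add: ripple_outside_strip)
  qed
  then have "norm (\<Sum>k<n. ripple_zbar k z) \<le> (\<Sum>k<n. 2 * (amplitude k * g (line_index k) k))"
    by (intro sum_norm_le)
  also have "\<dots> = 2 * (\<Sum>k<n. amplitude k * g (line_index k) k)"
    by (simp add: sum_distrib_left)
  also have "\<dots> \<le> 2 * (6 / 50)"
  proof (intro mult_left_mono sum_amplitude_le g)
    show "(\<Sum>k<n. g j k) \<le> 6" for j
      unfolding g_def by (rule sum_truncated_ratio_le[where r = scale])
        (rule scale_pos scale_Suc_half | simp add: d_def)+
  qed auto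
  finally show ?thesis by simp
qed

text \<open>The weights \<open>2 ^ k\<close> turn the number of strips containing \<open>z\<close> into a majorant of its own square, by the
  Cauchy--Schwarz inequality, and are compensated by the widths of the strips.\<close>

definition overlap :: "complex \<Rightarrow> real" where
  "overlap z = (\<Sum>k. 2 ^ k * indicator (strip k) z)"

lemma measure_ball_strip_le:
  "measure lborel (cball 0 R \<inter> strip k) \<le> 6 * measure lborel (cball (0::complex) (R + 1)) * scale k"
proof -
  have "cball 0 R \<inter> strip k = {z \<in> cball 0 R. \<bar>Im (cnj u * z) - height k\<bar> < 3 * scale k}"
    by (auto simp: strip_def)
  then show ?thesis
    using measure_strip_le[OF norm_u, of "3 * scale k" R "height k"] scale_pos[of k] by (simp add: mult_ac)
qed

text \<open>By the Borel--Cantelli lemma in every ball, since the widths of the strips are summable.\<close>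

lemma AE_eventually_not_in_strip: "AE z in lborel. \<forall>\<^sub>F k in sequentially. z \<notin> strip k"
proof -
  have "AE z in lborel. \<forall>\<^sub>F k in sequentially. z \<in> space lborel - cball 0 (real R) \<inter> strip k" for R :: nat
  proof (rule borel_cantelli_AE1)
    show "emeasure lborel (cball 0 (real R) \<inter> strip k) < \<infinity>" for k
      by (intro emeasure_bounded_finite bounded_Int) auto
    show "summable (\<lambda>k. measure lborel (cball 0 (real R) \<inter> strip k))"
    proof (rule summable_comparison_test'[of "\<lambda>k. 6 * measure lborel (cball (0::complex) (real R + 1)) * (1/2) ^ k" 0])
      show "norm (measure lborel (cball 0 (real R) \<inter> strip k))
          \<le> 6 * measure lborel (cball (0::complex) (real R + 1)) * (1/2) ^ k" for k
        using order_trans[OF measure_ball_strip_le[of R k] mult_left_mono[OF scale_le[of k]]] by simp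
    qed (intro summable_mult summable_geometric; simp)
  qed (use open_strip in auto)
  then have "AE z in lborel. \<forall>R::nat. \<forall>\<^sub>F k in sequentially. z \<in> space lborel - cball 0 (real R) \<inter> strip k"
    by (subst AE_all_countable) blast
  then show ?thesis
  proof eventually_elim
    case (elim z)
    obtain R :: nat where "norm z \<le> real R" using real_arch_simple by blast
    then show ?case using elim[rule_format, of R] by (simp add: mem_cball_0)
  qed
qed

text \<open>Termwise integration: in a ball the strips have measure at most a constant times \<open>scale k\<close>.\<close>

lemma overlap_integrable: "set_integrable lborel (cball 0 R) overlap"
proof -
  define M where "M = 6 * measure lborel (cball (0::complex) (R + 1))"
  define g where "g k z = 2 ^ k * indicat_real (cball 0 R \<inter> strip k) z" for k and z :: complex
  have sets: "cball 0 R \<inter> strip k \<in> sets lborel" for k using open_strip by auto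
  have fin: "emeasure lborel (cball 0 R \<inter> strip k) < \<infinity>" for k
    by (intro emeasure_bounded_finite bounded_Int) auto
  have int: "integrable lborel (g k)" for k
    unfolding g_def using sets fin by (intro integrable_mult_right integrable_real_indicator) auto
  have "integrable lborel (\<lambda>z. \<Sum>k. g k z)"
  proof (rule integrable_suminf[OF int])
    show "AE z in lborel. summable (\<lambda>k. norm (g k z))"
      using AE_eventually_not_in_strip
    proof eventually_elim
      case (elim z)
      then have "\<forall>\<^sub>F k in sequentially. norm (g k z) = 0"
        by (rule eventually_mono) (simp add: g_def)
      then show ?case
        using summable_cong[of "\<lambda>k. norm (g k z)" "\<lambda>_. 0"] by simp
    qed
    have "norm (g k z) = g k z" for k z by (simp add: g_def)
    then have le: "(\<integral>z. norm (g k z) \<partial>lborel) \<le> M * (2 ^ k * scale k)" for k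
      using mult_left_mono[OF measure_ball_strip_le[of R k], of "2 ^ k"] sets fin
      by (simp add: g_def[abs_def] M_def mult_ac)
    show "summable (\<lambda>k. \<integral>z. norm (g k z) \<partial>lborel)"
      by (rule summable_comparison_test'[OF summable_mult[OF summable_scale_2, of M], of 0])
         (use le in simp)
  qed
  moreover have "(\<Sum>k. g k z) = indicator (cball 0 R) z *\<^sub>R overlap z" for z
    by (cases "z \<in> cball 0 R") (simp_all add: g_def overlap_def indicator_inter_arith)
  ultimately show ?thesis by (simp add: set_integrable_def)
qed

lemma sum_ripple_z_square_le:
  assumes "\<forall>\<^sub>F k in sequentially. z \<notin> strip k"
  shows "(\<Sum>k<n. ripple_z k z)\<^sup>2 \<le> 2 * overlap z"
proof -
  define D where "D k = indicat_real (strip k) z" for k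
  have "\<bar>\<Sum>k<n. ripple_z k z\<bar> \<le> (\<Sum>k<n. D k)"
  proof -
    have "\<bar>ripple_z k z\<bar> \<le> D k" for k
    proof (cases "z \<in> strip k")
      case True
      have "\<bar>ripple_z k z\<bar> \<le> 4 * \<bar>amplitude k\<bar>" unfolding ripple_z_def by (rule wave_z_bound)
      also have "\<dots> \<le> 1" using amplitude_bounds[of k] by simp
      finally show ?thesis using True by (simp add: D_def)
    qed (simp add: ripple_outside_strip D_def)
    then show ?thesis using sum_norm_le[of "{..<n}" "\<lambda>k. ripple_z k z" D] by simp
  qed
  then have "(\<Sum>k<n. ripple_z k z)\<^sup>2 \<le> (\<Sum>k<n. D k)\<^sup>2" by (rule power2_le_iff_abs_le[THEN iffD2, rotated]) (auto simp: D_def intro: sum_nonneg)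
  also have "(\<Sum>k<n. D k) = (\<Sum>k<n. sqrt ((1/2) ^ k) * (sqrt (2 ^ k) * D k))"
    by (intro sum.cong) (simp_all add: mult.assoc[symmetric] real_sqrt_mult[symmetric] power_mult_distrib[symmetric])
  also have "\<dots>\<^sup>2 \<le> (\<Sum>k<n. (sqrt ((1/2) ^ k))\<^sup>2) * (\<Sum>k<n. (sqrt (2 ^ k) * D k)\<^sup>2)"
    by (rule Cauchy_Schwarz_ineq_sum)
  also have "\<dots> = (\<Sum>k<n. (1/2) ^ k) * (\<Sum>k<n. 2 ^ k * D k)"
  proof -
    have "(D k)\<^sup>2 = D k" for k by (simp add: D_def indicator_def)
    then show ?thesis by (simp add: power_mult_distrib)
  qed
  also have "\<dots> \<le> 2 * overlap z"
  proof (rule mult_mono)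
    have "(\<Sum>j<n. (1/2::real) ^ j) \<le> (\<Sum>j. (1/2) ^ j)"
      by (intro sum_le_suminf summable_geometric) auto
    then show "(\<Sum>j<n. (1/2::real) ^ j) \<le> 2" by (simp add: suminf_geometric)
    have "\<forall>\<^sub>F k in sequentially. 2 ^ k * D k = 0"
      using assms by (rule eventually_mono) (simp add: D_def)
    then have "summable (\<lambda>k. 2 ^ k * D k)" using summable_cong[of "\<lambda>k. 2 ^ k * D k" "\<lambda>_. 0"] by simp
    then show "(\<Sum>k<n. 2 ^ k * D k) \<le> overlap z"
      unfolding overlap_def D_def[symmetric] by (intro sum_le_suminf) (auto simp: D_def)
  qed (auto simp: D_def intro!: sum_nonneg)
  finally show ?thesis .
qed

lemma convergent_sum_of_eventually_0:
  fixes g :: "nat \<Rightarrow> 'a::real_normed_vector"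
  assumes "\<forall>\<^sub>F k in sequentially. g k = 0"
  shows "convergent (\<lambda>n. \<Sum>k<n. g k)"
  using summable_cong[OF assms] by (simp add: summable_iff_convergent)

text \<open>Outside a null set only finitely many ripples have a nonzero derivative at a given point, so
  that the derivatives of the partial sums are eventually constant there.\<close>

theorem quasiconformal_qc_map: "quasiconformal qc_map"
proof (rule quasiconformal_limit)
  let ?P = "\<lambda>n z. 1 + \<i> * of_real (\<Sum>k<n. ripple_z k z)"
  show "((\<lambda>z. z + (\<Sum>k<n. ripple k z)) has_derivative
      wirtinger (?P n z) (\<Sum>k<n. ripple_zbar k z)) (at z)" for n z
  proof -
    have d: "((\<lambda>z. z + (\<Sum>k<n. ripple k z)) has_derivative
        (\<lambda>w. w + (\<Sum>k<n. wirtinger (\<i> * of_real (ripple_z k z)) (ripple_zbar k z) w))) (at z)"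
      unfolding ripple_def ripple_z_def ripple_zbar_def
      by (intro has_derivative_add has_derivative_ident has_derivative_sum has_derivative_wave norm_u scale_pos)
    have "w + (\<Sum>k<n. wirtinger (\<i> * of_real (ripple_z k z)) (ripple_zbar k z) w)
        = wirtinger (?P n z) (\<Sum>k<n. ripple_zbar k z) w" for w
      by (simp add: wirtinger_def sum.distrib sum_distrib_left sum_distrib_right algebra_simps)
    with d show ?thesis by simp
  qed
  show "continuous_on UNIV (?P n)" "continuous_on UNIV (\<lambda>z. \<Sum>k<n. ripple_zbar k z)" for n
    unfolding ripple_z_def ripple_zbar_def by (intro continuous_intros wave_continuous scale_pos)+
  show "Re (?P n z) = 1" for n z by simp
  show "norm (\<Sum>k<n. ripple_zbar k z) \<le> 1/3" for n z by (rule norm_sum_ripple_zbar_le)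
  show "norm ((z + (\<Sum>k<n. ripple k z)) - qc_map z) \<le> 2 * (1/2) ^ n" for n z
    by (rule norm_qc_map_minus_partial_sum_le)
  show "(\<lambda>n. 2 * (1/2::real) ^ n) \<longlonglongrightarrow> 0"
    by (intro tendsto_mult_right_zero LIMSEQ_realpow_zero) auto
  show "AE z in lborel. convergent (\<lambda>n. ?P n z)"
    using AE_eventually_not_in_strip
  proof eventually_elim
    case (elim z)
    have "convergent (\<lambda>n. \<Sum>k<n. ripple_z k z)"
      by (rule convergent_sum_of_eventually_0) (use elim in \<open>rule eventually_mono, simp add: ripple_outside_strip\<close>)
    then obtain l where l: "(\<lambda>n. \<Sum>k<n. ripple_z k z) \<longlonglongrightarrow> l" by (auto simp: convergent_def)
    have "(\<lambda>n. ?P n z) \<longlonglongrightarrow> 1 + \<i> * of_real l"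
      by (intro tendsto_intros l)
    then show ?case by (rule convergentI)
  qed
  show "AE z in lborel. convergent (\<lambda>n. \<Sum>k<n. ripple_zbar k z)"
    using AE_eventually_not_in_strip
  proof eventually_elim
    case (elim z)
    show ?case
      by (rule convergent_sum_of_eventually_0) (use elim in \<open>rule eventually_mono, simp add: ripple_outside_strip\<close>)
  qed
  show "AE z in lborel. \<forall>n. (norm (?P n z))\<^sup>2 \<le> 1 + 2 * overlap z"
    using AE_eventually_not_in_strip
  proof eventually_elim
    case (elim z)
    then show ?case using sum_ripple_z_square_le[OF elim] by (simp add: cmod_power2 del: of_real_sum)
  qed
  show "set_integrable lborel (cball 0 R) (\<lambda>z. 1 + 2 * overlap z)" for R
  proof (rule set_integral_add)
    show "set_integrable lborel (cball 0 R) (\<lambda>_::complex. 1::real)"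
      unfolding set_integrable_def by (intro borel_integrable_compact) auto
    show "set_integrable lborel (cball 0 R) (\<lambda>z. 2 * overlap z)"
      using overlap_integrable[of R] by simp
  qed
qed

text \<open>The amplitude with which ripple \<open>k\<close> is seen on line \<open>j\<close>: the full amplitude if the ripple belongs to this line,
  and the amplitude damped by the profile otherwise.\<close>

definition coefficient :: "nat \<Rightarrow> nat \<Rightarrow> real" where
  "coefficient j k = amplitude k * bump ((y j - height k) / scale k)"

lemma lacunary_coefficient:
  "lacunary_cosine_series (coefficient j) scale ((1/2) ^ j / 100)"
proof
  show "0 \<le> coefficient j k" "coefficient j k \<le> 1" for k
    using amplitude_bounds[of k] bump_bounds(1,2)[of "(y j - height k) / scale k"]
      mult_mono[of "amplitude k" 1 "bump ((y j - height k) / scale k)" 1]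
    by (auto simp: coefficient_def)
  show "\<exists>\<^sub>\<infinity>k. coefficient j k = (1/2) ^ j / 100"
  proof -
    have "coefficient j (prod_encode (j, n)) = (1/2) ^ j / 100" for n
      by (simp add: coefficient_def height_def line_index_def amplitude_def bump_def cap_def)
    then have "range (\<lambda>n. prod_encode (j, n)) \<subseteq> {k. coefficient j k = (1/2) ^ j / 100}" by auto
    moreover have "infinite (range (\<lambda>n. prod_encode (j, n)))"
      by (rule range_inj_infinite) (auto intro!: injI)
    ultimately show ?thesis
      by (simp add: frequently_cofinite infinite_super)
  qed
qed (use scale_pos scale_Suc in auto)

lemma qc_map_on_line:
  assumes "Im (cnj u * z) = y j"
  shows "Im (cnj u * qc_map z)
    = y j + lacunary_cosine_series.series (coefficient j) scale (Re (cnj u * z))"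
proof -
  interpret lacunary_cosine_series "coefficient j" scale "(1/2) ^ j / 100"
    by (rule lacunary_coefficient)
  have "cnj u * qc_map z = cnj u * z + (\<Sum>k. cnj u * ripple k z)"
    by (simp add: qc_map_def distrib_left suminf_mult[OF summable_ripple])
  then have "Im (cnj u * qc_map z) = y j + (\<Sum>k. Im (cnj u * ripple k z))"
    using assms bounded_linear.suminf[OF bounded_linear_Im summable_mult[OF summable_ripple, of "cnj u" z]]
    by simp
  moreover have "Im (cnj u * ripple k z) = coefficient j k * scale k * cos (Re (cnj u * z) / scale k)" for k
    unfolding ripple_def wave_on_line[OF norm_u] assms by (simp add: coefficient_def mult_ac)
  ultimately show ?thesis by (simp only: series_def)
qed

end

section \<open>Subarcs of the images of the lines\<close>

lemma curve_length_ge_sum: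
  assumes "incseq t" "range t \<subseteq> {0..1}"
  shows "(\<Sum>i<n. ennreal (dist (\<gamma> (t i)) (\<gamma> (t (Suc i))))) \<le> curve_length \<gamma>"
proof -
  define ts where "ts = map t [0..<Suc n]"
  have "sorted ts"
    unfolding sorted_iff_nth_mono using incseqD[OF assms(1)] by (auto simp: ts_def simp del: upt_Suc)
  moreover have "set ts \<subseteq> {0..1}"
  proof -
    have "set ts \<subseteq> range t" by (auto simp: ts_def simp del: upt_Suc)
    then show ?thesis using assms(2) by (rule order_trans)
  qed
  ultimately have "(\<Sum>i<length ts - 1. ennreal (dist (\<gamma> (ts ! i)) (\<gamma> (ts ! Suc i)))) \<le> curve_length \<gamma>"
    unfolding curve_length_def
    by (intro SUP_upper[where i = ts
          and f = "\<lambda>ts. \<Sum>i<length ts - 1. ennreal (dist (\<gamma> (ts ! i)) (\<gamma> (ts ! Suc i)))"]) simp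
  moreover have "(\<Sum>i<length ts - 1. ennreal (dist (\<gamma> (ts ! i)) (\<gamma> (ts ! Suc i))))
      = (\<Sum>i<n. ennreal (dist (\<gamma> (t i)) (\<gamma> (t (Suc i)))))"
    by (intro sum.cong) (auto simp: ts_def simp del: upt_Suc)
  ultimately show ?thesis by simp
qed

text \<open>The intermediate value theorem is applied successively on the remaining part of \<open>[0, 1]\<close>.\<close>

lemma increasing_times_for_equidistant_values:
  fixes \<sigma> :: "real \<Rightarrow> real"
  assumes cont: "continuous_on {0..1} \<sigma>" and "n > 0"
  shows "\<exists>t. incseq t \<and> range t \<subseteq> {0..1} \<and>
    (\<forall>i\<le>n. \<sigma> (t i) = \<sigma> 0 + real i * ((\<sigma> 1 - \<sigma> 0) / real n))"
proof -
  define x where "x i = \<sigma> 0 + real (min i n) * ((\<sigma> 1 - \<sigma> 0) / real n)" for i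
  have "\<exists>t. \<forall>i. (t i \<in> {0..1} \<and> \<sigma> (t i) = x i) \<and> t i \<le> t (Suc i)"
  proof (rule dependent_nat_choice)
    show "\<exists>t. t \<in> {0..1} \<and> \<sigma> t = x 0" by (intro exI[of _ 0]) (simp add: x_def)
  next
    fix s i assume s: "s \<in> {0..1} \<and> \<sigma> s = x i"
    have conts: "continuous_on {s..1} \<sigma>" using cont by (rule continuous_on_subset) (use s in auto)
    define w where "w i = real (min i n) / real n" for i
    have w: "w i \<le> w (Suc i)" "w (Suc i) \<le> 1"
      using \<open>n > 0\<close> by (auto simp: w_def divide_right_mono)
    have x: "x i = \<sigma> 0 + w i * (\<sigma> 1 - \<sigma> 0)" for i by (simp add: x_def w_def)
    have "\<exists>t\<ge>s. t \<le> 1 \<and> \<sigma> t = x (Suc i)"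
    proof (cases "\<sigma> 0 \<le> \<sigma> 1")
      case True
      have "x i \<le> x (Suc i)" "x (Suc i) \<le> \<sigma> 1"
        using True mult_right_mono[OF w(1), of "\<sigma> 1 - \<sigma> 0"] mult_right_mono[OF w(2), of "\<sigma> 1 - \<sigma> 0"]
        unfolding x by auto
      then show ?thesis using IVT'[of \<sigma> s "x (Suc i)" 1] s conts by auto
    next
      case False
      have "x i \<ge> x (Suc i)" "x (Suc i) \<ge> \<sigma> 1"
        using mult_right_mono_neg[OF w(1), of "\<sigma> 1 - \<sigma> 0"] mult_right_mono_neg[OF w(2), of "\<sigma> 1 - \<sigma> 0"] False
        unfolding x mult_1_left by linarith+
      then show ?thesis using IVT2'[of \<sigma> 1 "x (Suc i)" s] s conts by auto
    qed
    then obtain t where "s \<le> t" "t \<le> 1" "\<sigma> t = x (Suc i)" by blast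
    then show "\<exists>t. (t \<in> {0..1} \<and> \<sigma> t = x (Suc i)) \<and> s \<le> t"
      using s by (intro exI[of _ t]) simp
  qed
  then obtain t where "\<forall>i. (t i \<in> {0..1} \<and> \<sigma> (t i) = x i) \<and> t i \<le> t (Suc i)" ..
  then have t: "t i \<in> {0..1}" "\<sigma> (t i) = x i" "t i \<le> t (Suc i)" for i by simp_all
  show ?thesis
  proof (intro exI[of _ t] conjI allI impI)
    show "incseq t" using t(3) by (rule incseq_SucI)
    show "\<sigma> (t i) = \<sigma> 0 + real i * ((\<sigma> 1 - \<sigma> 0) / real n)" if "i \<le> n" for i
      using that by (simp add: t(2) x_def)
  qed (use t(1) in auto)
qed

text \<open>The foot \<open>\<sigma> t\<close> of the preimage of \<open>\<gamma> t\<close> moves continuously between two different points of the line, so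
  the length of \<open>\<gamma>\<close> dominates the variation of the lacunary series between them.\<close>

lemma (in line_family) unrectifiable_subarc:
  assumes sub: "nontrivial_subarc \<gamma> (qc_map ` {z. Im (cnj u * z) = y j})"
  shows "unrectifiable \<gamma>"
proof -
  interpret lacunary_cosine_series "coefficient j" scale "(1/2) ^ j / 100"
    by (rule lacunary_coefficient)
  obtain g where g: "homeomorphism UNIV UNIV qc_map g"
    using quasiconformal_qc_map unfolding quasiconformal_def by blast
  have gq: "g (qc_map z) = z" and qg: "qc_map (g w) = w" for z w
    using homeomorphism_apply1[OF g, of z] homeomorphism_apply2[OF g, of w] by auto
  have arc: "arc \<gamma>" and img: "\<gamma> ` {0..1} \<subseteq> qc_map ` {z. Im (cnj u * z) = y j}"
    using sub by (auto simp: nontrivial_subarc_def path_image_def)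
  define \<sigma> where "\<sigma> t = Re (cnj u * g (\<gamma> t))" for t
  have Im_g: "Im (cnj u * g (\<gamma> t)) = y j" if "t \<in> {0..1}" for t
  proof -
    have "\<gamma> t \<in> qc_map ` {z. Im (cnj u * z) = y j}" using img that by (rule subsetD[OF _ imageI])
    then obtain z where "Im (cnj u * z) = y j" "\<gamma> t = qc_map z" by blast
    then show ?thesis by (simp only: gq)
  qed
  have Im_\<gamma>: "Im (cnj u * \<gamma> t) = y j + series (\<sigma> t)" if "t \<in> {0..1}" for t
    using qc_map_on_line[OF Im_g[OF that]] by (simp only: qg \<sigma>_def)
  have \<gamma>_cont: "continuous_on {0..1} \<gamma>" using arc by (simp add: arc_def path_def)
  have g_cont: "continuous_on UNIV g" using g by (simp add: homeomorphism_def)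
  have "continuous_on {0..1} (\<lambda>t. g (\<gamma> t))"
    by (rule continuous_on_compose2[OF g_cont \<gamma>_cont]) simp
  then have cont: "continuous_on {0..1} \<sigma>"
    unfolding \<sigma>_def by (intro continuous_intros)
  have "\<sigma> 0 \<noteq> \<sigma> 1"
  proof
    assume "\<sigma> 0 = \<sigma> 1"
    moreover have "Im (cnj u * g (\<gamma> 0)) = y j" by (rule Im_g) simp
    moreover have "Im (cnj u * g (\<gamma> 1)) = y j" by (rule Im_g) simp
    ultimately have "cnj u * g (\<gamma> 0) = cnj u * g (\<gamma> 1)"
      by (intro complex_eqI) (simp_all only: \<sigma>_def)
    then have "g (\<gamma> 0) = g (\<gamma> 1)" using norm_u by auto
    then have "\<gamma> 0 = \<gamma> 1" by (metis qg)
    then show False using arc by (auto simp: arc_def dest: inj_onD[of \<gamma> "{0..1}" 0 1])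
  qed
  have large: "ennreal V \<le> curve_length \<gamma>" for V
  proof -
    obtain n where "n > 0" and n: "(\<Sum>i<n. \<bar>series (\<sigma> 0 + real (Suc i) * ((\<sigma> 1 - \<sigma> 0) / n))
        - series (\<sigma> 0 + real i * ((\<sigma> 1 - \<sigma> 0) / n))\<bar>) > V"
      using series_unbounded_variation_either_direction[OF \<open>\<sigma> 0 \<noteq> \<sigma> 1\<close>] by blast
    obtain t where t: "incseq t" "range t \<subseteq> {0..1}"
      "\<And>i. i \<le> n \<Longrightarrow> \<sigma> (t i) = \<sigma> 0 + real i * ((\<sigma> 1 - \<sigma> 0) / real n)"
      using increasing_times_for_equidistant_values[OF cont \<open>n > 0\<close>] by blast
    have tin: "t i \<in> {0..1}" for i using t(2) by blast
    have "ennreal V \<le> ennreal (\<Sum>i<n. dist (\<gamma> (t i)) (\<gamma> (t (Suc i))))"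
    proof (rule ennreal_leI)
      have "\<bar>series (\<sigma> 0 + real (Suc i) * ((\<sigma> 1 - \<sigma> 0) / n)) - series (\<sigma> 0 + real i * ((\<sigma> 1 - \<sigma> 0) / n))\<bar>
          \<le> dist (\<gamma> (t i)) (\<gamma> (t (Suc i)))" if "i \<in> {..<n}" for i
      proof -
        have "Im (cnj u * (\<gamma> (t (Suc i)) - \<gamma> (t i))) = series (\<sigma> (t (Suc i))) - series (\<sigma> (t i))"
          unfolding right_diff_distrib minus_complex.sel Im_\<gamma>[OF tin] by simp
        then have "\<bar>series (\<sigma> (t (Suc i))) - series (\<sigma> (t i))\<bar> \<le> norm (cnj u * (\<gamma> (t (Suc i)) - \<gamma> (t i)))"
          by (metis abs_Im_le_cmod)
        also have "\<dots> = dist (\<gamma> (t i)) (\<gamma> (t (Suc i)))"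
          by (simp add: norm_mult norm_u dist_norm norm_minus_commute)
        finally show ?thesis using t(3)[of i] t(3)[of "Suc i"] that by simp
      qed
      then have "(\<Sum>i<n. \<bar>series (\<sigma> 0 + real (Suc i) * ((\<sigma> 1 - \<sigma> 0) / n)) - series (\<sigma> 0 + real i * ((\<sigma> 1 - \<sigma> 0) / n))\<bar>)
          \<le> (\<Sum>i<n. dist (\<gamma> (t i)) (\<gamma> (t (Suc i))))"
        by (rule sum_mono)
      with n show "V \<le> (\<Sum>i<n. dist (\<gamma> (t i)) (\<gamma> (t (Suc i))))" by linarith
    qed
    also have "\<dots> \<le> curve_length \<gamma>"
      using curve_length_ge_sum[OF t(1,2), of \<gamma> n] by (simp add: sum_ennreal)
    finally show ?thesis .
  qed
  show ?thesis
    unfolding unrectifiable_def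
  proof (cases "curve_length \<gamma>")
    case (real r)
    then show "curve_length \<gamma> = \<infinity>" using large[of "r + 1"] by (simp add: ennreal_le_iff)
  qed simp
qed

section \<open>Parallel lines as level sets\<close>

text \<open>The direction \<open>u\<close> is the normalised difference of two points of the line, and \<open>Im (cnj u * z)\<close> is the signed
  distance of \<open>z\<close> from the parallel line through the origin.\<close>

lemma line_eq_level_set:
  assumes "line L"
  obtains u c where "norm u = 1" "L = {z. Im (cnj u * z) = c}"
proof -
  have L: "affine L" "aff_dim L = 1" using assms by (auto simp: line_def)
  then have "L \<noteq> {}" by auto
  then obtain a where a: "a \<in> L" by blast
  have "L \<noteq> {a}" using L(2) by auto
  then obtain b where b: "b \<in> L" "b \<noteq> a" using a by blast
  have "affine hull {a, b} \<subseteq> L" using a b L(1) by (intro hull_minimal) auto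
  moreover have "aff_dim (affine hull {a, b}) = aff_dim L" using b(2) L(2) by (simp add: aff_dim_2)
  ultimately have Lab: "L = affine hull {a, b}"
    using affine_dim_equal[of "affine hull {a, b}" L] L(1) by auto
  define u where "u = sgn (b - a)"
  have u: "norm u = 1" using b(2) by (simp add: u_def norm_sgn)
  have uu: "cnj u * u = 1" using u complex_norm_square[of u] by (simp add: mult.commute)
  have ba: "b - a = of_real (norm (b - a)) * u" using b(2) by (simp add: u_def sgn_eq)
  show ?thesis
  proof (rule that[OF u])
    show "L = {z. Im (cnj u * z) = Im (cnj u * a)}"
    proof (intro set_eqI iffI)
      fix z assume "z \<in> L"
      then obtain s t where z: "z = s *\<^sub>R a + t *\<^sub>R b" "s + t = 1" unfolding Lab affine_hull_2 by auto
      then have s: "s = 1 - t" by simp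
      have "z = a + of_real t * (b - a)" unfolding z(1) s by (simp add: scaleR_conv_of_real algebra_simps)
      also have "\<dots> = a + of_real (t * norm (b - a)) * u" by (subst ba) simp
      finally have "cnj u * z = cnj u * a + of_real (t * norm (b - a)) * (cnj u * u)" by (simp add: algebra_simps)
      then show "z \<in> {z. Im (cnj u * z) = Im (cnj u * a)}"
        by (simp only: uu mem_Collect_eq plus_complex.sel mult_1_right Im_complex_of_real add_0_right)
    next
      fix z assume z: "z \<in> {z. Im (cnj u * z) = Im (cnj u * a)}"
      define s where "s = Re (cnj u * (z - a))"
      have eq: "cnj u * (z - a) = of_real s"
      proof (rule complex_eqI)
        show "Im (cnj u * (z - a)) = Im (of_real s)"
          using z by (simp only: right_diff_distrib minus_complex.sel mem_Collect_eq Im_complex_of_real diff_self)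
      qed (simp only: s_def Re_complex_of_real)
      have "z - a = (cnj u * u) * (z - a)" by (simp only: uu mult_1_left)
      also have "\<dots> = (cnj u * (z - a)) * u" by (simp only: mult_ac)
      also have "\<dots> = of_real s * u" by (simp only: eq)
      also have "\<dots> = of_real (s / norm (b - a)) * (b - a)" using b(2) by (subst (2) ba) simp
      finally have za: "z - a = of_real (s / norm (b - a)) * (b - a)" .
      define t where "t = s / norm (b - a)"
      have "z = a + of_real t * (b - a)"
        using za[folded t_def] by (simp only: diff_eq_eq add.commute)
      then have "z = (1 - t) *\<^sub>R a + t *\<^sub>R b"
        by (simp add: scaleR_conv_of_real algebra_simps)
      moreover have "(1 - t) + t = 1" by simp
      ultimately show "z \<in> L" unfolding Lab affine_hull_2 by blast
    qed
  qed
qed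

lemma translate_level_set:
  "(\<lambda>z. a + z) ` {z. Im (cnj u * z) = c} = {z. Im (cnj u * z) = c + Im (cnj u * a)}"
proof (intro set_eqI iffI)
  fix w assume "w \<in> {z. Im (cnj u * z) = c + Im (cnj u * a)}"
  then show "w \<in> (\<lambda>z. a + z) ` {z. Im (cnj u * z) = c}"
    by (intro image_eqI[of _ _ "w - a"]) (auto simp: algebra_simps)
qed (auto simp: algebra_simps)

theorem corollary1p6:
  fixes L :: "nat \<Rightarrow> complex set"
  assumes "\<And>j. j \<ge> 1 \<Longrightarrow> line (L j)"
    and "\<And>i j. i \<ge> 1 \<Longrightarrow> j \<ge> 1 \<Longrightarrow> affine_parallel (L i) (L j)"
  shows "\<exists>f. quasiconformal f \<and>
           (\<forall>j\<ge>1. \<forall>\<gamma>. nontrivial_subarc \<gamma> (f ` L j) \<longrightarrow> unrectifiable \<gamma>)"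
proof -
  obtain u c where u: "norm u = 1" and L1: "L 1 = {z. Im (cnj u * z) = c}"
    using line_eq_level_set[OF assms(1)[of 1]] by auto
  have "\<exists>h. L j = {z. Im (cnj u * z) = h}" if "j \<ge> 1" for j
  proof -
    have "affine_parallel (L 1) (L j)" using assms(2)[of 1 j] that by simp
    then obtain a where "L j = (\<lambda>z. a + z) ` L 1" unfolding affine_parallel_def by blast
    then show ?thesis unfolding L1 translate_level_set by blast
  qed
  then obtain y where y: "\<And>j. j \<ge> 1 \<Longrightarrow> L j = {z. Im (cnj u * z) = y j}" by metis
  interpret line_family u y by unfold_locales (rule u)
  show ?thesis
  proof (intro exI[of _ qc_map] conjI allI impI)
    fix j :: nat and \<gamma> assume "1 \<le> j" "nontrivial_subarc \<gamma> (qc_map ` L j)"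
    then show "unrectifiable \<gamma>" using unrectifiable_subarc[of \<gamma> j] by (simp only: y)
  qed (rule quasiconformal_qc_map)
qed

end
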